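(* Fix a reward with values in $[0,1]$ and a user-task distribution $\mathcal D_{\mathrm{user}}$ not depending on the agent or the step. For $k=0,\dots,K-1$ run step $k$ by the one-candidate update protocol with Two-Gate validation under the standard evaluation conditions at that step (all defined in the context), obtaining agents $A_0,\dots,A_K$; later steps may depend arbitrarily on earlier ones. Let $\mathcal A=\{k<K:\text{the candidate is adopted at step }k\}$. If the deterministic step risks $$\beta_{\mathrm{step},k}=2\beta_Z+\beta_{F,k}+\beta_R+2(n_F+n_R)\beta_V^{(1)}$$ (evaluated with the step-$k$ parameters) satisfy $\sum_{k=0}^{K-1}\beta_{\mathrm{step},k}\le\beta_{\mathrm{run}}$, then with probability at least $1-\beta_{\mathrm{run}}$, $$J_{\mathrm{user}}(A_K)-J_{\mathrm{user}}(A_0)\ \ge\ \sum_{k\in\mathcal A}\Delta_k .$$ No independence between steps is required.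
   Context: **Setting.** $\mathcal T_{\mathrm{user}}$ (user tasks) and $\mathcal O$ (outputs) are measurable spaces. An agent $A$ is a Markov kernel $A(\cdot\mid t)$ from tasks to outputs. The reward $r:\mathcal T_{\mathrm{user}}\times\mathcal O\to[0,1]$ and failure detector $\phi:\mathcal T_{\mathrm{user}}\times\mathcal O\to\{0,1\}$ are jointly measurable and fixed. Put $V(A,t)=\int r(t,o)A(do\mid t)$, $J_{\mathrm{user}}(A)=\int V(A,t)\mathcal D_{\mathrm{user}}(dt)$, $\psi_A(t)=\int\phi(t,o)A(do\mid t)$, $Z_k=\int\psi_{A_k}d\mathcal D_{\mathrm{user}}\in(0,1)$, $\mathcal D_{F,k}(dt)=\frac{\psi_{A_k}(t)}{Z_k}\mathcal D_{\mathrm{user}}(dt)$, $\mathcal D_{R,k}(dt)=\frac{1-\psi_{A_k}(t)}{1-Z_k}\mathcal D_{\mathrm{user}}(dt)$, $\mathrm{Adv}_{A_k}(\widetilde A,t)=V(\widetilde A,t)-V(A_k,t)$. **One-candidate update protocol at step $k$.** $\mathcal M$ is the measurable space of valid modifications; $c\in\mathcal M$ gives an agent $A_k\oplus c$; $\bot$ denotes a failed generation output. (1) $A_k$ handles at most a fixed finite number of arriving user tasks; the first $n_F$ failure-marked tasks form the generation material (abstain if there are fewer). A terminal output $\Delta C\in\mathcal M\sqcup\{\bot\}$ is drawn from the current agent's generation kernel given this material; abstain if $\Delta C=\bot$. $\mathsf{Cand}_k=\{\Delta C\in\mathcal M\}$ and $\widetilde A=A_k\oplus\Delta C$. (2) A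 stored sample of $n_R$ labelled records $(t_j^R,\phi_j^R)$ is used (recollected after each adoption); $S_R=\{j:\phi_j^R=0\}$. Abstain unless a valid stored sample with $|S_R|\ge1$ is available (event $\mathsf{Ready}_{R,k}$). (3) After the candidate, all radii, risks, horizon and return rule are frozen, a new window of $H_{F,k}<\infty$ task arrivals is observed with $A_k$ and $\phi$ fixed; the first $n_F$ failure-marked tasks $t^F_1,\dots,t^F_{n_F}$ are returned (event $\mathsf{Ret}_{F,k}$), otherwise abstain. $\mathsf{Ready}_k=\mathsf{Ret}_{F,k}\cap\mathsf{Ready}_{R,k}$. (4) On $\mathsf{Cand}_k\cap\mathsf{Ready}_k$, for each evaluation task $t$ and each $A\in\{A_k,\widetilde A\}$, given the frozen agents and records, compute $\hat V(A,t)=\frac1m\sum_{l=1}^m r(t,o_l)$ from $m$ fresh i.i.d. rollouts $o_l\sim A(\cdot\mid t)$, with independent groups for the two agents. Estimates: $\hat Z_k=\frac1{n_R}\sum_j\phi_j^R$, $\hat L_k=\hat Z_k\frac1{n_F}\sum_i[\hat V(\widetilde A,t_i^F)-\hat V(A_k,t_i^F)]$, $\hat D_R=\frac1{|S_R|}\sum_{j\in S_R}|\hat V(\widetilde A,t_j^R)-\hat V(A_k,t_j^R)|$. Radii, for deterministic risks $\beta_V^{(1)},\beta_Z,\beta_R,\beta_{F,k}\in(0,1)$ and block gap $\ell$: $\varepsilon_V=\sqrt{\log(2/\beta_V^{(1)})/(2m)}$; $\varepsilon_Z=\sqrt{\log(2/\widetilde\beta_Z)/(2n_R)}$ with $\widetilde\beta_Z=\beta_Z-2n_R\beta(\ell)$;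 $\varepsilon_R=\sqrt{\log(2/\widetilde\beta_R)/(2n_R)}$ with $\widetilde\beta_R=\beta_R-2n_R\beta(\ell)$; $\varepsilon_F$ a radius frozen before (3); $\varepsilon_L=\varepsilon_Z+(\hat Z_k+\varepsilon_Z)(2\varepsilon_V+\varepsilon_F)$; $\varepsilon_D=(2\varepsilon_V+\varepsilon_R+\varepsilon_Z)/(1-\hat Z_k)$. **Two-Gate validation** (thresholds $\tau,\delta>0$): on $\mathsf{Cand}_k\cap\mathsf{Ready}_k$, adopt if and only if $\hat L_k\ge\tau$, $\hat D_R\le\delta$ and $$\Delta_k:=\tau-\varepsilon_L-(1-\hat Z_k+\varepsilon_Z)(\delta+\varepsilon_D)>0 .$$ Off $\mathsf{Cand}_k\cap\mathsf{Ready}_k$ set $\Delta_k=0$ and do not adopt. $A_{k+1}=\widetilde A$ if adopted, $A_{k+1}=A_k$ otherwise. **Standard evaluation conditions at step $k$.** (a) The task stream $(T_n)$ is stationary ergodic with marginal $\mathcal D_{\mathrm{user}}$ and $\beta$-mixing: $\beta(j)=\sup_n\mathbb E[\sup_{B\in\sigma(T_{n+j},T_{n+j+1},\dots)}|\mathbb P(B\mid T_1,\dots,T_n)-\mathbb P(B)|]\to0$. (b) While $A_k$ is the current agent, $O_n\sim A_k(\cdot\mid T_n)$ and, given $T_n$, $O_n$ is conditionally independent of all other $(T_m,O_m)$, $m\neq n$, and of all fresh rollouts; the mark is $\Phi_n=\phi(T_n,O_n)$; repeated evaluations of $\phi$ and $r$ for a fixed agent and task are i.i.d. (c) The generation material is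 disjoint from the failure batch and stored sample. Let $\mathcal G_k$ contain the current agent, the frozen candidate, generation information and randomness, and any stored-sample offset. The joint law $\mathbb P$ of this information and the stored records is within total variation $2n_R\beta(\ell)$ of a reference law $\mathbb P^\circ$ with the same $\mathcal G_k$-marginal under which, conditionally on $\mathcal G_k$, the stored tasks are i.i.d. from $\mathcal D_{\mathrm{user}}$ and, given them, the labels are independent $\mathrm{Bernoulli}(\psi_{A_k}(t_j^R))$. (d) With $f=\mathrm{Adv}_{A_k}(\widetilde A,\cdot)$, $\mathbb P\bigl(\mathsf{Ret}_{F,k}\cap\{|\frac1{n_F}\sum_i f(t_i^F)-\mathbb E_{\mathcal D_{F,k}}f|>\varepsilon_F\}\bigr)\le\beta_{F,k}$, where $\widetilde A$, $\varepsilon_F$ and the return rule do not depend on outcomes of the window in (3). (e) $2n_R\beta(\ell)<\min\{\beta_Z,\beta_R\}$. *)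

theory Defs
  imports "HOL-Probability.Probability"
begin

section \<open>Agents, values and failure distributions\<close>

type_synonym ('t, 'o) agent = "'t \<Rightarrow> 'o measure"

text \<open>
  An agent is a Markov kernel, i.e. a function from tasks to measures on outputs. Since agents are
  random during a run, the class of admissible agents carries a \<open>\<sigma>\<close>-algebra. The kernels have no
  canonical one, so \<open>agent_space\<close> is arbitrary, subject only to joint measurability of the evaluation
  \<open>(A, t) \<mapsto> A t\<close>; this makes every element of \<open>agent_space\<close> a Markov kernel.
\<close>

record ('t, 'o, 'c) setting =
  task_space :: "'t measure"
  output_space :: "'o measure"
  agent_space :: "('t, 'o) agent measure"
  mod_space :: "'c measure"
  oplus :: "('t, 'o) agent \<Rightarrow> 'c \<Rightarrow> ('t, 'o) agent"
  reward :: "'t \<Rightarrow> 'o \<Rightarrow> real"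
  detector :: "'t \<Rightarrow> 'o \<Rightarrow> bool"
  user_dist :: "'t measure"

definition valid_setting :: "('t, 'o, 'c) setting \<Rightarrow> bool" where
  "valid_setting S \<longleftrightarrow>
     prob_space (user_dist S) \<and> sets (user_dist S) = sets (task_space S) \<and>
     (\<lambda>(A, t). A t) \<in> agent_space S \<Otimes>\<^sub>M task_space S \<rightarrow>\<^sub>M prob_algebra (output_space S) \<and>
     (\<lambda>(A, c). oplus S A c) \<in> agent_space S \<Otimes>\<^sub>M mod_space S \<rightarrow>\<^sub>M agent_space S \<and>
     (\<lambda>(t, y). reward S t y) \<in> borel_measurable (task_space S \<Otimes>\<^sub>M output_space S) \<and>
     (\<forall>t\<in>space (task_space S). \<forall>y\<in>space (output_space S). 0 \<le> reward S t y \<and> reward S t y \<le> 1) \<and>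
     (\<lambda>(t, y). detector S t y) \<in> task_space S \<Otimes>\<^sub>M output_space S \<rightarrow>\<^sub>M count_space UNIV"

definition V :: "('t, 'o, 'c) setting \<Rightarrow> ('t, 'o) agent \<Rightarrow> 't \<Rightarrow> real" where
  "V S A t = (\<integral>y. reward S t y \<partial>(A t))"

definition J_user :: "('t, 'o, 'c) setting \<Rightarrow> ('t, 'o) agent \<Rightarrow> real" where
  "J_user S A = (\<integral>t. V S A t \<partial>user_dist S)"

definition psi :: "('t, 'o, 'c) setting \<Rightarrow> ('t, 'o) agent \<Rightarrow> 't \<Rightarrow> real" where
  "psi S A t = (\<integral>y. of_bool (detector S t y) \<partial>(A t))"

definition Z :: "('t, 'o, 'c) setting \<Rightarrow> ('t, 'o) agent \<Rightarrow> real" where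
  "Z S A = (\<integral>t. psi S A t \<partial>user_dist S)"

definition D_F :: "('t, 'o, 'c) setting \<Rightarrow> ('t, 'o) agent \<Rightarrow> 't measure" where
  "D_F S A = density (user_dist S) (\<lambda>t. ennreal (psi S A t / Z S A))"

definition Adv :: "('t, 'o, 'c) setting \<Rightarrow> ('t, 'o) agent \<Rightarrow> ('t, 'o) agent \<Rightarrow> 't \<Rightarrow> real" where
  "Adv S A A' t = V S A' t - V S A t"


section \<open>Probabilistic preliminaries\<close>

definition gen_sigma :: "'w measure \<Rightarrow> 'x measure \<Rightarrow> ('i \<Rightarrow> 'w \<Rightarrow> 'x) \<Rightarrow> 'i set \<Rightarrow> 'w measure" where
  "gen_sigma P M X I = sigma (space P) {X i -` B \<inter> space P | i B. i \<in> I \<and> B \<in> sets M}"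

text \<open>
  \<open>cond_law_on P F D X N \<kappa>\<close>: on the event \<open>D\<close>, the conditional law of \<open>X\<close> given the sub-\<open>\<sigma>\<close>-algebra
  \<open>F\<close> is \<open>\<kappa>\<close>.
\<close>

definition cond_law_on ::
  "'w measure \<Rightarrow> 'w measure \<Rightarrow> 'w set \<Rightarrow> ('w \<Rightarrow> 'x) \<Rightarrow> 'x measure \<Rightarrow> ('w \<Rightarrow> 'x measure) \<Rightarrow> bool"
where
  "cond_law_on P F D X N \<kappa> \<longleftrightarrow>
     subalgebra P F \<and> D \<in> sets F \<and> X \<in> P \<rightarrow>\<^sub>M N \<and>
     \<kappa> \<in> restrict_space F D \<rightarrow>\<^sub>M prob_algebra N \<and>
     (\<forall>E\<in>sets F. E \<subseteq> D \<longrightarrow> (\<forall>B\<in>sets N.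
        measure P (E \<inter> X -` B) = (\<integral>\<omega>. indicator E \<omega> * measure (\<kappa> \<omega>) B \<partial>P)))"

definition total_variation :: "'x measure \<Rightarrow> 'x measure \<Rightarrow> real" where
  "total_variation M N = (SUP B\<in>sets M. \<bar>measure M B - measure N B\<bar>)"

text \<open>
  \<open>\<beta>(j) = sup\<^sub>n E[sup\<^sub>B |P(B | X\<^sub>0, \<dots>, X\<^sub>n) - P(B)|]\<close> with \<open>B\<close> ranging over \<open>\<sigma>(X\<^sub>n\<^sub>+\<^sub>j, X\<^sub>n\<^sub>+\<^sub>j\<^sub>+\<^sub>1, \<dots>)\<close>.
  Conditional probabilities are only determined almost surely, so the inner supremum over uncountably
  many \<open>B\<close> is the essential supremum. As this is the a.e. least almost sure upper bound, its expectation
  is the least expectation of an integrable almost sure upper bound.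
\<close>

definition beta_mix :: "'w measure \<Rightarrow> 'x measure \<Rightarrow> (nat \<Rightarrow> 'w \<Rightarrow> 'x) \<Rightarrow> nat \<Rightarrow> real" where
  "beta_mix P M X j =
     (SUP n. INF g \<in> {g. integrable P g \<and>
          (\<forall>B\<in>sets (gen_sigma P M X {n + j..}).
             AE \<omega> in P. \<bar>real_cond_exp P (gen_sigma P M X {..n}) (indicator B) \<omega> - measure P B\<bar> \<le> g \<omega>)}.
        \<integral>\<omega>. g \<omega> \<partial>P)"

definition stationary_seq :: "'w measure \<Rightarrow> 'x measure \<Rightarrow> (nat \<Rightarrow> 'w \<Rightarrow> 'x) \<Rightarrow> bool" where
  "stationary_seq P M X \<longleftrightarrow>
     distr P (PiM UNIV (\<lambda>_. M)) (\<lambda>\<omega> n. X (Suc n) \<omega>) = distr P (PiM UNIV (\<lambda>_. M)) (\<lambda>\<omega> n. X n \<omega>)"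

definition ergodic_seq :: "'w measure \<Rightarrow> 'x measure \<Rightarrow> (nat \<Rightarrow> 'w \<Rightarrow> 'x) \<Rightarrow> bool" where
  "ergodic_seq P M X \<longleftrightarrow>
     (\<forall>B\<in>sets (PiM UNIV (\<lambda>_. M)).
        {x \<in> space (PiM UNIV (\<lambda>_. M)). (\<lambda>n. x (Suc n)) \<in> B} = B \<longrightarrow>
        measure P {\<omega> \<in> space P. (\<lambda>n. X n \<omega>) \<in> B} \<in> {0, 1})"

text \<open>Disjoint union of \<open>M\<close> with an extra point; \<open>None\<close> is the failed generation output \<open>\<bottom>\<close>.\<close>

definition option_space :: "'c measure \<Rightarrow> 'c option measure" where
  "option_space M =
     sigma (insert None (Some ` space M)) (insert {None} ((\<lambda>B. Some ` B) ` sets M))"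


section \<open>Runs\<close>

record step_params =
  n_F :: nat
  n_R :: nat
  n_roll :: nat
  gap :: nat
  gen_cap :: nat
  risk_V :: real
  risk_Z :: real
  risk_R :: real
  risk_F :: real
  tau :: real
  delta :: real

text \<open>
  Time is counted in task arrivals: \<open>task n\<close> is the \<open>n\<close>-th arriving user task and \<open>outp n\<close> the output of
  the agent handling it. \<open>past n\<close> is the information present just before arrival \<open>n\<close> is observed. Step
  \<open>k\<close> lasts from arrival \<open>step_start k\<close> up to, not including, \<open>step_start (k + 1)\<close>. Within it,
  generation handles the arrivals in \<open>[gen_start k, gen_end k)\<close> and the failure window consists of those
  in \<open>[win_start k, win_start k + horizon k)\<close>.
  \<open>gen_kernel k \<omega>\<close> is the generation kernel of the agent current at step \<open>k\<close>; like that agent, it may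
  depend on the earlier steps. \<open>gen_out k\<close> is \<open>\<Delta>C\<close>, and \<open>frozen k\<close> is the \<open>\<sigma>\<close>-algebra \<open>\<G>\<^sub>k\<close>.
  \<open>avail k\<close> is the event that a valid stored sample is available; record \<open>j\<close> was taken at arrival
  \<open>rec_pos k j\<close>, so \<open>rec_pos k 0\<close> is the sample offset. Off \<open>avail k\<close> the record variables are
  placeholders.
\<close>

record ('w, 't, 'o, 'c) run =
  Pr :: "'w measure"
  task :: "nat \<Rightarrow> 'w \<Rightarrow> 't"
  outp :: "nat \<Rightarrow> 'w \<Rightarrow> 'o"
  past :: "nat \<Rightarrow> 'w measure"
  params :: "nat \<Rightarrow> step_params"
  agent :: "nat \<Rightarrow> 'w \<Rightarrow> ('t, 'o) agent"
  step_start :: "nat \<Rightarrow> 'w \<Rightarrow> nat"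
  gen_start :: "nat \<Rightarrow> 'w \<Rightarrow> nat"
  gen_end :: "nat \<Rightarrow> 'w \<Rightarrow> nat"
  win_start :: "nat \<Rightarrow> 'w \<Rightarrow> nat"
  horizon :: "nat \<Rightarrow> 'w \<Rightarrow> nat"
  gen_kernel :: "nat \<Rightarrow> 'w \<Rightarrow> (nat \<Rightarrow> 't) \<Rightarrow> 'c option measure"
  gen_out :: "nat \<Rightarrow> 'w \<Rightarrow> 'c option"
  avail :: "nat \<Rightarrow> 'w set"
  rec_pos :: "nat \<Rightarrow> nat \<Rightarrow> 'w \<Rightarrow> nat"
  rec_task :: "nat \<Rightarrow> nat \<Rightarrow> 'w \<Rightarrow> 't"
  rec_label :: "nat \<Rightarrow> nat \<Rightarrow> 'w \<Rightarrow> bool"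
  frozen :: "nat \<Rightarrow> 'w measure"
  eps_F :: "nat \<Rightarrow> 'w \<Rightarrow> real"
  rollout :: "nat \<Rightarrow> (nat + nat) \<times> bool \<times> nat \<Rightarrow> 'w \<Rightarrow> 'o"

abbreviation beta :: "('t, 'o, 'c) setting \<Rightarrow> ('w, 't, 'o, 'c) run \<Rightarrow> nat \<Rightarrow> real" where
  "beta S R \<equiv> beta_mix (Pr R) (task_space S) (task R)"

definition mark :: "('t, 'o, 'c) setting \<Rightarrow> ('w, 't, 'o, 'c) run \<Rightarrow> nat \<Rightarrow> 'w \<Rightarrow> bool" where
  "mark S R n \<omega> = detector S (task R n \<omega>) (outp R n \<omega>)"

text \<open>Arrival numbers of the failure-marked tasks in \<open>[a, b)\<close>, in order of arrival.\<close>

definition fails ::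
  "('t, 'o, 'c) setting \<Rightarrow> ('w, 't, 'o, 'c) run \<Rightarrow> nat \<Rightarrow> nat \<Rightarrow> 'w \<Rightarrow> nat list"
where
  "fails S R a b \<omega> = filter (\<lambda>n. mark S R n \<omega>) [a..<b]"

definition gen_fails :: "('t, 'o, 'c) setting \<Rightarrow> ('w, 't, 'o, 'c) run \<Rightarrow> nat \<Rightarrow> 'w \<Rightarrow> nat list" where
  "gen_fails S R k \<omega> = fails S R (gen_start R k \<omega>) (gen_end R k \<omega>) \<omega>"

definition enough :: "('t, 'o, 'c) setting \<Rightarrow> ('w, 't, 'o, 'c) run \<Rightarrow> nat \<Rightarrow> 'w set" where
  "enough S R k = {\<omega> \<in> space (Pr R). n_F (params R k) \<le> length (gen_fails S R k \<omega>)}"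

definition material :: "('t, 'o, 'c) setting \<Rightarrow> ('w, 't, 'o, 'c) run \<Rightarrow> nat \<Rightarrow> 'w \<Rightarrow> nat \<Rightarrow> 't" where
  "material S R k \<omega> = (\<lambda>i\<in>{..<n_F (params R k)}. task R (gen_fails S R k \<omega> ! i) \<omega>)"

definition Cand :: "('w, 't, 'o, 'c) run \<Rightarrow> nat \<Rightarrow> 'w set" where
  "Cand R k = {\<omega> \<in> space (Pr R). gen_out R k \<omega> \<noteq> None}"

text \<open>The candidate agent, meaningful on \<open>Cand R k\<close>.\<close>

definition cand :: "('t, 'o, 'c) setting \<Rightarrow> ('w, 't, 'o, 'c) run \<Rightarrow> nat \<Rightarrow> 'w \<Rightarrow> ('t, 'o) agent" where
  "cand S R k \<omega> = oplus S (agent R k \<omega>) (the (gen_out R k \<omega>))"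

definition S_R :: "('w, 't, 'o, 'c) run \<Rightarrow> nat \<Rightarrow> 'w \<Rightarrow> nat set" where
  "S_R R k \<omega> = {j. j < n_R (params R k) \<and> \<not> rec_label R k j \<omega>}"

definition ReadyR :: "('w, 't, 'o, 'c) run \<Rightarrow> nat \<Rightarrow> 'w set" where
  "ReadyR R k = {\<omega> \<in> space (Pr R). \<omega> \<in> avail R k \<and> 1 \<le> card (S_R R k \<omega>)}"

definition win_end :: "('w, 't, 'o, 'c) run \<Rightarrow> nat \<Rightarrow> 'w \<Rightarrow> nat" where
  "win_end R k \<omega> = win_start R k \<omega> + horizon R k \<omega>"

definition win_fails :: "('t, 'o, 'c) setting \<Rightarrow> ('w, 't, 'o, 'c) run \<Rightarrow> nat \<Rightarrow> 'w \<Rightarrow> nat list" where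
  "win_fails S R k \<omega> = fails S R (win_start R k \<omega>) (win_end R k \<omega>) \<omega>"

definition RetF :: "('t, 'o, 'c) setting \<Rightarrow> ('w, 't, 'o, 'c) run \<Rightarrow> nat \<Rightarrow> 'w set" where
  "RetF S R k = {\<omega> \<in> space (Pr R). n_F (params R k) \<le> length (win_fails S R k \<omega>)}"

definition fail_task :: "('t, 'o, 'c) setting \<Rightarrow> ('w, 't, 'o, 'c) run \<Rightarrow> nat \<Rightarrow> nat \<Rightarrow> 'w \<Rightarrow> 't" where
  "fail_task S R k i \<omega> = task R (win_fails S R k \<omega> ! i) \<omega>"

definition Ready :: "('t, 'o, 'c) setting \<Rightarrow> ('w, 't, 'o, 'c) run \<Rightarrow> nat \<Rightarrow> 'w set" where
  "Ready S R k = RetF S R k \<inter> ReadyR R k"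


subsection \<open>Estimates, radii and validation\<close>

text \<open>
  An evaluation is indexed by \<open>Inl i\<close> (failure task \<open>i\<close>) or \<open>Inr j\<close> (stored record \<open>j\<close>) and by the agent
  evaluated: \<open>False\<close> for the current agent, \<open>True\<close> for the candidate.
\<close>

definition eval_task :: "('t, 'o, 'c) setting \<Rightarrow> ('w, 't, 'o, 'c) run \<Rightarrow> nat \<Rightarrow> nat + nat \<Rightarrow> 'w \<Rightarrow> 't" where
  "eval_task S R k e \<omega> = (case e of Inl i \<Rightarrow> fail_task S R k i \<omega> | Inr j \<Rightarrow> rec_task R k j \<omega>)"

definition eval_agent :: "('t, 'o, 'c) setting \<Rightarrow> ('w, 't, 'o, 'c) run \<Rightarrow> nat \<Rightarrow> bool \<Rightarrow> 'w \<Rightarrow> ('t, 'o) agent" where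
  "eval_agent S R k b \<omega> = (if b then cand S R k \<omega> else agent R k \<omega>)"

definition rollout_index :: "('w, 't, 'o, 'c) run \<Rightarrow> nat \<Rightarrow> nat set \<Rightarrow> ((nat + nat) \<times> bool \<times> nat) set" where
  "rollout_index R k J = ({..<n_F (params R k)} <+> J) \<times> UNIV \<times> {..<n_roll (params R k)}"

definition V_hat :: "('t, 'o, 'c) setting \<Rightarrow> ('w, 't, 'o, 'c) run \<Rightarrow> nat \<Rightarrow> bool \<Rightarrow> nat + nat \<Rightarrow> 'w \<Rightarrow> real" where
  "V_hat S R k b e \<omega> =
     1 / real (n_roll (params R k)) *
     (\<Sum>l<n_roll (params R k). reward S (eval_task S R k e \<omega>) (rollout R k (e, b, l) \<omega>))"

definition Z_hat :: "('w, 't, 'o, 'c) run \<Rightarrow> nat \<Rightarrow> 'w \<Rightarrow> real" where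
  "Z_hat R k \<omega> = 1 / real (n_R (params R k)) * (\<Sum>j<n_R (params R k). of_bool (rec_label R k j \<omega>))"

definition L_hat :: "('t, 'o, 'c) setting \<Rightarrow> ('w, 't, 'o, 'c) run \<Rightarrow> nat \<Rightarrow> 'w \<Rightarrow> real" where
  "L_hat S R k \<omega> =
     Z_hat R k \<omega> * (1 / real (n_F (params R k)) *
       (\<Sum>i<n_F (params R k). V_hat S R k True (Inl i) \<omega> - V_hat S R k False (Inl i) \<omega>))"

definition D_hat :: "('t, 'o, 'c) setting \<Rightarrow> ('w, 't, 'o, 'c) run \<Rightarrow> nat \<Rightarrow> 'w \<Rightarrow> real" where
  "D_hat S R k \<omega> =
     1 / real (card (S_R R k \<omega>)) *
     (\<Sum>j\<in>S_R R k \<omega>. \<bar>V_hat S R k True (Inr j) \<omega> - V_hat S R k False (Inr j) \<omega>\<bar>)"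

definition eps_V :: "('w, 't, 'o, 'c) run \<Rightarrow> nat \<Rightarrow> real" where
  "eps_V R k = sqrt (ln (2 / risk_V (params R k)) / (2 * real (n_roll (params R k))))"

definition risk_Z_adj :: "('t, 'o, 'c) setting \<Rightarrow> ('w, 't, 'o, 'c) run \<Rightarrow> nat \<Rightarrow> real" where
  "risk_Z_adj S R k = risk_Z (params R k) - 2 * real (n_R (params R k)) * beta S R (gap (params R k))"

definition risk_R_adj :: "('t, 'o, 'c) setting \<Rightarrow> ('w, 't, 'o, 'c) run \<Rightarrow> nat \<Rightarrow> real" where
  "risk_R_adj S R k = risk_R (params R k) - 2 * real (n_R (params R k)) * beta S R (gap (params R k))"

definition eps_Z :: "('t, 'o, 'c) setting \<Rightarrow> ('w, 't, 'o, 'c) run \<Rightarrow> nat \<Rightarrow> real" where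
  "eps_Z S R k = sqrt (ln (2 / risk_Z_adj S R k) / (2 * real (n_R (params R k))))"

definition eps_R :: "('t, 'o, 'c) setting \<Rightarrow> ('w, 't, 'o, 'c) run \<Rightarrow> nat \<Rightarrow> real" where
  "eps_R S R k = sqrt (ln (2 / risk_R_adj S R k) / (2 * real (n_R (params R k))))"

definition eps_L :: "('t, 'o, 'c) setting \<Rightarrow> ('w, 't, 'o, 'c) run \<Rightarrow> nat \<Rightarrow> 'w \<Rightarrow> real" where
  "eps_L S R k \<omega> =
     eps_Z S R k + (Z_hat R k \<omega> + eps_Z S R k) * (2 * eps_V R k + eps_F R k \<omega>)"

definition eps_D :: "('t, 'o, 'c) setting \<Rightarrow> ('w, 't, 'o, 'c) run \<Rightarrow> nat \<Rightarrow> 'w \<Rightarrow> real" where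
  "eps_D S R k \<omega> = (2 * eps_V R k + eps_R S R k + eps_Z S R k) / (1 - Z_hat R k \<omega>)"

definition Delta :: "('t, 'o, 'c) setting \<Rightarrow> ('w, 't, 'o, 'c) run \<Rightarrow> nat \<Rightarrow> 'w \<Rightarrow> real" where
  "Delta S R k \<omega> =
     (if \<omega> \<in> Cand R k \<inter> Ready S R k
      then tau (params R k) - eps_L S R k \<omega>
           - (1 - Z_hat R k \<omega> + eps_Z S R k) * (delta (params R k) + eps_D S R k \<omega>)
      else 0)"

definition adopts :: "('t, 'o, 'c) setting \<Rightarrow> ('w, 't, 'o, 'c) run \<Rightarrow> nat \<Rightarrow> 'w \<Rightarrow> bool" where
  "adopts S R k \<omega> \<longleftrightarrow>
     \<omega> \<in> Cand R k \<inter> Ready S R k \<and>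
     L_hat S R k \<omega> \<ge> tau (params R k) \<and> D_hat S R k \<omega> \<le> delta (params R k) \<and> Delta S R k \<omega> > 0"

definition adopted :: "('t, 'o, 'c) setting \<Rightarrow> ('w, 't, 'o, 'c) run \<Rightarrow> nat \<Rightarrow> 'w \<Rightarrow> nat set" where
  "adopted S R K \<omega> = {k. k < K \<and> adopts S R k \<omega>}"

definition step_risk :: "step_params \<Rightarrow> real" where
  "step_risk p = 2 * risk_Z p + risk_F p + risk_R p + 2 * real (n_F p + n_R p) * risk_V p"


section \<open>Protocol and evaluation conditions\<close>

abbreviation pre :: "('w, 't, 'o, 'c) run \<Rightarrow> ('w \<Rightarrow> nat) \<Rightarrow> 'w measure" where
  "pre R \<equiv> filtration.pre_sigma (space (Pr R)) (past R)"

text \<open>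
  Information consisting of \<open>base\<close>, the whole task stream, and the outputs at all arrivals before \<open>\<sigma>\<close>.
  Outputs, generated candidates and rollouts are drawn from their kernels conditionally on such
  information. The whole task stream is included because these draws depend on other tasks only through
  the stated arguments.
\<close>

definition info :: "('t, 'o, 'c) setting \<Rightarrow> ('w, 't, 'o, 'c) run \<Rightarrow> 'w measure \<Rightarrow> ('w \<Rightarrow> nat) \<Rightarrow> 'w measure" where
  "info S R base \<sigma> =
     sigma (space (Pr R))
       (sets base \<union>
        {task R n -` B \<inter> space (Pr R) | n B. B \<in> sets (task_space S)} \<union>
        {{\<omega> \<in> space (Pr R). n < \<sigma> \<omega> \<and> outp R n \<omega> \<in> B} | n B. B \<in> sets (output_space S)})"

text \<open>
  The last conjunct says that \<open>past n\<close> knows nothing about the tasks from arrival \<open>n\<close> on beyond what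
  the earlier tasks tell. Together with the conditional law of the outputs below, it makes "measurable
  with respect to the past of \<open>win_start k\<close>" mean "not dependent on outcomes of the failure window".
\<close>

definition valid_run :: "('t, 'o, 'c) setting \<Rightarrow> ('w, 't, 'o, 'c) run \<Rightarrow> nat \<Rightarrow> bool" where
  "valid_run S R K \<longleftrightarrow>
     prob_space (Pr R) \<and>
     filtration (space (Pr R)) (past R) \<and> (\<forall>n. subalgebra (Pr R) (past R n)) \<and>
     (\<forall>n. task R n \<in> Pr R \<rightarrow>\<^sub>M task_space S \<and> outp R n \<in> Pr R \<rightarrow>\<^sub>M output_space S) \<and>
     (\<forall>n. \<forall>m<n. task R m \<in> past R n \<rightarrow>\<^sub>M task_space S \<and> outp R m \<in> past R n \<rightarrow>\<^sub>M output_space S) \<and>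
     (\<forall>k\<le>K. stopping_time (past R) (step_start R k) \<and>
             agent R k \<in> pre R (step_start R k) \<rightarrow>\<^sub>M agent_space S) \<and>
     (\<forall>n. \<forall>B\<in>sets (gen_sigma (Pr R) (task_space S) (task R) {n..}).
        AE \<omega> in Pr R.
          real_cond_exp (Pr R) (past R n) (indicator B) \<omega> =
          real_cond_exp (Pr R) (gen_sigma (Pr R) (task_space S) (task R) {..<n}) (indicator B) \<omega>)"

definition valid_params :: "step_params \<Rightarrow> bool" where
  "valid_params p \<longleftrightarrow>
     n_F p \<ge> 1 \<and> n_R p \<ge> 1 \<and> n_roll p \<ge> 1 \<and>
     risk_V p \<in> {0<..<1} \<and> risk_Z p \<in> {0<..<1} \<and> risk_R p \<in> {0<..<1} \<and> risk_F p \<in> {0<..<1} \<and>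
     tau p > 0 \<and> delta p > 0"

definition generation_phase :: "('t, 'o, 'c) setting \<Rightarrow> ('w, 't, 'o, 'c) run \<Rightarrow> nat \<Rightarrow> bool" where
  "generation_phase S R k \<longleftrightarrow>
     stopping_time (past R) (gen_start R k) \<and> stopping_time (past R) (gen_end R k) \<and>
     (\<forall>\<omega>\<in>space (Pr R). step_start R k \<omega> \<le> gen_start R k \<omega> \<and> gen_start R k \<omega> \<le> gen_end R k \<omega> \<and>
        gen_end R k \<omega> \<le> gen_start R k \<omega> + gen_cap (params R k) \<and>
        gen_end R k \<omega> \<le> win_start R k \<omega>) \<and>
     (\<lambda>(\<omega>, x). gen_kernel R k \<omega> x) \<in>
        pre R (gen_start R k) \<Otimes>\<^sub>M PiM {..<n_F (params R k)} (\<lambda>_. task_space S)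
          \<rightarrow>\<^sub>M prob_algebra (option_space (mod_space S)) \<and>
     cond_law_on (Pr R) (info S R (pre R (gen_start R k)) (gen_end R k)) (enough S R k)
       (gen_out R k) (option_space (mod_space S)) (\<lambda>\<omega>. gen_kernel R k \<omega> (material S R k \<omega>)) \<and>
     (\<forall>\<omega>\<in>space (Pr R) - enough S R k. gen_out R k \<omega> = None)"

text \<open>
  Recollection after each adoption: an available sample was recorded while the agent current at step
  \<open>k\<close> was in use, i.e. since the start of some step \<open>i \<le> k\<close> with no adoption at steps \<open>i, \<dots>, k - 1\<close>.
\<close>

definition stored_sample :: "('t, 'o, 'c) setting \<Rightarrow> ('w, 't, 'o, 'c) run \<Rightarrow> nat \<Rightarrow> bool" where
  "stored_sample S R k \<longleftrightarrow>
     avail R k \<in> sets (pre R (win_start R k)) \<and>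
     (\<forall>j<n_R (params R k).
        rec_pos R k j \<in> Pr R \<rightarrow>\<^sub>M count_space UNIV \<and>
        rec_task R k j \<in> Pr R \<rightarrow>\<^sub>M task_space S \<and>
        rec_label R k j \<in> Pr R \<rightarrow>\<^sub>M count_space UNIV \<and>
        rec_task R k j \<in> restrict_space (pre R (win_start R k)) (avail R k) \<rightarrow>\<^sub>M task_space S \<and>
        rec_label R k j \<in> restrict_space (pre R (win_start R k)) (avail R k) \<rightarrow>\<^sub>M count_space UNIV) \<and>
     (\<forall>\<omega>\<in>avail R k.
        strict_mono_on {..<n_R (params R k)} (\<lambda>j. rec_pos R k j \<omega>) \<and>
        (\<exists>i\<le>k. (\<forall>h\<in>{i..<k}. \<not> adopts S R h \<omega>) \<and>
               (\<forall>j<n_R (params R k). step_start R i \<omega> \<le> rec_pos R k j \<omega>)) \<and>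
        (\<forall>j<n_R (params R k).
           rec_pos R k j \<omega> < win_start R k \<omega> \<and>
           rec_task R k j \<omega> = task R (rec_pos R k j \<omega>) \<omega> \<and>
           rec_label R k j \<omega> = mark S R (rec_pos R k j \<omega>) \<omega>))"

definition failure_window :: "('t, 'o, 'c) setting \<Rightarrow> ('w, 't, 'o, 'c) run \<Rightarrow> nat \<Rightarrow> bool" where
  "failure_window S R k \<longleftrightarrow>
     stopping_time (past R) (win_start R k) \<and>
     gen_out R k \<in> pre R (win_start R k) \<rightarrow>\<^sub>M option_space (mod_space S) \<and>
     eps_F R k \<in> borel_measurable (pre R (win_start R k)) \<and>
     horizon R k \<in> pre R (win_start R k) \<rightarrow>\<^sub>M count_space UNIV \<and>
     (\<forall>\<omega>\<in>space (Pr R). win_start R k \<omega> \<le> step_start R (Suc k) \<omega>) \<and>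
     (\<forall>\<omega>\<in>Cand R k. win_end R k \<omega> \<le> step_start R (Suc k) \<omega>)"

text \<open>
  Fresh rollouts: given everything that happened up to the end of the window, in particular the frozen
  agents and records, the rollouts for all evaluation tasks and both agents are independent, the ones
  for agent \<open>A\<close> and task \<open>t\<close> having law \<open>A t\<close>. Only the stored tasks with \<open>j \<in> S_R\<close> are evaluated, hence
  the case distinction over the possible values \<open>J\<close> of this random set.
\<close>

definition evaluation :: "('t, 'o, 'c) setting \<Rightarrow> ('w, 't, 'o, 'c) run \<Rightarrow> nat \<Rightarrow> bool" where
  "evaluation S R k \<longleftrightarrow>
     (\<forall>s\<in>rollout_index R k {..<n_R (params R k)}.
        rollout R k s \<in> pre R (step_start R (Suc k)) \<rightarrow>\<^sub>M output_space S) \<and>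
     (\<forall>J\<subseteq>{..<n_R (params R k)}.
        cond_law_on (Pr R) (info S R (pre R (win_start R k)) (win_end R k))
          {\<omega> \<in> Cand R k \<inter> Ready S R k. S_R R k \<omega> = J}
          (\<lambda>\<omega>. \<lambda>s\<in>rollout_index R k J. rollout R k s \<omega>)
          (PiM (rollout_index R k J) (\<lambda>_. output_space S))
          (\<lambda>\<omega>. PiM (rollout_index R k J)
                  (\<lambda>(e, b, l). eval_agent S R k b \<omega> (eval_task S R k e \<omega>))))"

definition two_gate_update :: "('t, 'o, 'c) setting \<Rightarrow> ('w, 't, 'o, 'c) run \<Rightarrow> nat \<Rightarrow> bool" where
  "two_gate_update S R k \<longleftrightarrow>
     (\<forall>\<omega>\<in>space (Pr R).
        agent R (Suc k) \<omega> = (if adopts S R k \<omega> then cand S R k \<omega> else agent R k \<omega>))"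

definition one_candidate_step :: "('t, 'o, 'c) setting \<Rightarrow> ('w, 't, 'o, 'c) run \<Rightarrow> nat \<Rightarrow> bool" where
  "one_candidate_step S R k \<longleftrightarrow>
     valid_params (params R k) \<and>
     (AE \<omega> in Pr R. Z S (agent R k \<omega>) \<in> {0<..<1}) \<and>
     generation_phase S R k \<and> stored_sample S R k \<and> failure_window S R k \<and>
     evaluation S R k \<and> two_gate_update S R k"


definition task_stream_cond :: "('t, 'o, 'c) setting \<Rightarrow> ('w, 't, 'o, 'c) run \<Rightarrow> bool" where
  "task_stream_cond S R \<longleftrightarrow>
     stationary_seq (Pr R) (task_space S) (task R) \<and>
     ergodic_seq (Pr R) (task_space S) (task R) \<and>
     (\<forall>n. distr (Pr R) (task_space S) (task R n) = user_dist S) \<and>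
     beta S R \<longlonglongrightarrow> 0"

text \<open>
  \<open>O\<^sub>n\<close> has law \<open>A\<^sub>k(\<cdot> | T\<^sub>n)\<close> given all tasks, all earlier outputs and everything else drawn before
  arrival \<open>n\<close>, including earlier rollouts. Later outputs and rollouts are in turn drawn conditionally on
  information containing \<open>O\<^sub>n\<close>. The conditioning is sequential because candidates, and therefore later
  agents and their outputs, may depend on \<open>O\<^sub>n\<close> through the protocol. For a fixed agent this is
  conditional independence of \<open>O\<^sub>n\<close> from all other tasks and outputs and from all rollouts, given \<open>T\<^sub>n\<close>.
\<close>

definition output_cond :: "('t, 'o, 'c) setting \<Rightarrow> ('w, 't, 'o, 'c) run \<Rightarrow> nat \<Rightarrow> bool" where
  "output_cond S R k \<longleftrightarrow>
     (\<forall>n. cond_law_on (Pr R) (info S R (past R n) (\<lambda>_. n))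
            {\<omega> \<in> space (Pr R). step_start R k \<omega> \<le> n \<and> n < step_start R (Suc k) \<omega>}
            (outp R n) (output_space S) (\<lambda>\<omega>. agent R k \<omega> (task R n \<omega>)))"

definition record_space :: "('t, 'o, 'c) setting \<Rightarrow> ('t \<times> bool) measure" where
  "record_space S = task_space S \<Otimes>\<^sub>M count_space UNIV"

text \<open>Law of a task from the user distribution with a Bernoulli label of parameter \<open>psi S A t\<close>.\<close>

definition record_law :: "('t, 'o, 'c) setting \<Rightarrow> ('t, 'o) agent \<Rightarrow> ('t \<times> bool) measure" where
  "record_law S A =
     user_dist S \<bind> (\<lambda>t. distr (measure_pmf (bernoulli_pmf (psi S A t))) (record_space S) (Pair t))"

definition records :: "('w, 't, 'o, 'c) run \<Rightarrow> nat \<Rightarrow> 'w \<Rightarrow> nat \<Rightarrow> 't \<times> bool" where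
  "records R k \<omega> = (\<lambda>j\<in>{..<n_R (params R k)}. (rec_task R k j \<omega>, rec_label R k j \<omega>))"

abbreviation records_space :: "('t, 'o, 'c) setting \<Rightarrow> ('w, 't, 'o, 'c) run \<Rightarrow> nat \<Rightarrow> (nat \<Rightarrow> 't \<times> bool) measure" where
  "records_space S R k \<equiv> PiM {..<n_R (params R k)} (\<lambda>_. record_space S)"

text \<open>
  The joint law of the information \<open>\<G>\<^sub>k\<close> and the records is the law of \<open>\<omega> \<mapsto> (\<omega>, records R k \<omega>)\<close>, the
  first factor carrying the \<open>\<sigma>\<close>-algebra \<open>\<G>\<^sub>k\<close>. \<open>Q\<close> is the reference law on the same space.
\<close>

definition record_cond :: "('t, 'o, 'c) setting \<Rightarrow> ('w, 't, 'o, 'c) run \<Rightarrow> nat \<Rightarrow> bool" where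
  "record_cond S R k \<longleftrightarrow>
     (\<forall>\<omega>\<in>Cand R k.
        set (take (n_F (params R k)) (gen_fails S R k \<omega>)) \<inter>
        (set (take (n_F (params R k)) (win_fails S R k \<omega>)) \<union>
         (if \<omega> \<in> avail R k then (\<lambda>j. rec_pos R k j \<omega>) ` {..<n_R (params R k)} else {})) = {}) \<and>
     subalgebra (Pr R) (frozen R k) \<and>
     agent R k \<in> frozen R k \<rightarrow>\<^sub>M agent_space S \<and>
     gen_out R k \<in> frozen R k \<rightarrow>\<^sub>M option_space (mod_space S) \<and>
     enough S R k \<in> sets (frozen R k) \<and>
     material S R k \<in> restrict_space (frozen R k) (enough S R k)
       \<rightarrow>\<^sub>M PiM {..<n_F (params R k)} (\<lambda>_. task_space S) \<and>
     rec_pos R k 0 \<in> frozen R k \<rightarrow>\<^sub>M count_space UNIV \<and>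
     (\<exists>Q. prob_space Q \<and> sets Q = sets (frozen R k \<Otimes>\<^sub>M records_space S R k) \<and>
        distr Q (frozen R k) fst = distr (Pr R) (frozen R k) (\<lambda>\<omega>. \<omega>) \<and>
        cond_law_on Q (vimage_algebra (space Q) fst (frozen R k)) (space Q) snd (records_space S R k)
          (\<lambda>(\<omega>, _). PiM {..<n_R (params R k)} (\<lambda>_. record_law S (agent R k \<omega>))) \<and>
        total_variation
          (distr (Pr R) (frozen R k \<Otimes>\<^sub>M records_space S R k) (\<lambda>\<omega>. (\<omega>, records R k \<omega>))) Q
          \<le> 2 * real (n_R (params R k)) * beta S R (gap (params R k)))"

definition batch_cond :: "('t, 'o, 'c) setting \<Rightarrow> ('w, 't, 'o, 'c) run \<Rightarrow> nat \<Rightarrow> bool" where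
  "batch_cond S R k \<longleftrightarrow>
     measure (Pr R)
       {\<omega> \<in> Cand R k \<inter> RetF S R k.
          \<bar>1 / real (n_F (params R k)) *
             (\<Sum>i<n_F (params R k). Adv S (agent R k \<omega>) (cand S R k \<omega>) (fail_task S R k i \<omega>))
           - (\<integral>t. Adv S (agent R k \<omega>) (cand S R k \<omega>) t \<partial>D_F S (agent R k \<omega>))\<bar>
          > eps_F R k \<omega>}
     \<le> risk_F (params R k)"

definition standard_conditions :: "('t, 'o, 'c) setting \<Rightarrow> ('w, 't, 'o, 'c) run \<Rightarrow> nat \<Rightarrow> bool" where
  "standard_conditions S R k \<longleftrightarrow>
     task_stream_cond S R \<and> output_cond S R k \<and> record_cond S R k \<and> batch_cond S R k \<and>
     2 * real (n_R (params R k)) * beta S R (gap (params R k))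
       < min (risk_Z (params R k)) (risk_R (params R k))"

end

theory Submission
  imports Defs
begin

text \<open>
  Writing \<open>f\<close> for the advantage of the candidate, the gain of an adoption is
  \<open>Z E\<^sub>F f + E[(1 - \<psi>) f]\<close>. The first term is estimated by \<open>L_hat\<close>. The second is at least
  \<open>- E[(1 - \<psi>) |f|]\<close>, whose empirical version averages \<open>|f|\<close> over the unmarked records but divides
  by the full sample size \<open>n_R\<close>; this keeps the summands independent, and it equals
  \<open>(1 - Z_hat)\<close> times the average controlled by \<open>D_hat\<close>. Hoeffding's inequality is applied to
  the label frequency and to this loss under the reference law of the stored sample, the total
  variation distance being added to the risk, and to the rollouts conditionally on the information at
  the end of the failure window. Outside the resulting exceptional event each adoption gains at least
  \<open>Delta\<close>, so the gains telescope, and the exceptional events of all steps are combined by a union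
  bound, which needs no independence.
\<close>

section \<open>Concentration under product and conditional laws\<close>

text \<open>The randomness is split so that each bound meets one layer of it. The reference law
  describes the stored records jointly with \<open>frozen R k\<close> and says nothing about
  rollouts. Hence the retained loss is stated with true advantages, which depend on frozen
  information and records only, and rollouts enter later through the error \<open>eps_V\<close> of
  each mean. Since the reference law is only close to the true one, the radii use the reduced risks
  \<open>risk_Z_adj\<close> and \<open>risk_R_adj\<close>; adding the total variation bound gives
  back exactly \<open>risk_Z\<close> and \<open>risk_R\<close>. The set of evaluated records is
  random, so rollouts are treated on each event \<open>S_R R k \<omega> = J\<close>. These events
  are disjoint, and bounds proportional to their probabilities add up without a factor for the
  number of sets \<open>J\<close>. Conditional laws are specified on rectangles, whereas a deviation
  event compares a draw with a centre that depends on the conditioning; this forces an extension to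
  product-measurable sets. Measurability has content here: \<open>measure\<close> is 0 on
  non-measurable sets, so a bound on an exceptional set is informative only once the set is known to
  be measurable.\<close>

text \<open>\<open>I\<close> may be a proper part of \<open>J\<close> because the rollouts of one
  task and one agent form a block of the product over all evaluations. With
  \<open>n = card I\<close>, the radius solves
  \<open>2 * exp (-2 * n * \<epsilon>^2) = \<beta>\<close>, and \<open>\<beta> \<le> 2\<close> keeps
  the logarithm nonnegative.\<close>

lemma hoeffding_PiM:
  fixes h :: "'i \<Rightarrow> 'a \<Rightarrow> real"
  assumes J: "finite J" "I \<subseteq> J" "I \<noteq> {}"
    and M: "\<And>i. i \<in> J \<Longrightarrow> prob_space (M i)"
    and h: "\<And>i. i \<in> I \<Longrightarrow> h i \<in> borel_measurable (M i)"
    and h01: "\<And>i x. i \<in> I \<Longrightarrow> x \<in> space (M i) \<Longrightarrow> h i x \<in> {0..1}"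
    and mean: "\<And>i. i \<in> I \<Longrightarrow> (\<integral>x. h i x \<partial>M i) = \<mu>"
    and \<beta>: "0 < \<beta>" "\<beta> \<le> 2"
  shows "measure (PiM J M) {x \<in> space (PiM J M).
           \<bar>1 / real (card I) * (\<Sum>i\<in>I. h i (x i)) - \<mu>\<bar> > sqrt (ln (2 / \<beta>) / (2 * real (card I)))} \<le> \<beta>"
proof -
  let ?P = "PiM J M"
  interpret P: prob_space ?P using M by (rule prob_space_PiM)
  have fin: "finite I" using J finite_subset by blast
  define n where "n = real (card I)"
  have n: "n > 0" using fin J by (simp add: n_def card_gt_0_iff)
  have hP[measurable]: "(\<lambda>x. h i (x i)) \<in> borel_measurable ?P" if "i \<in> I" for i
    using that J by (intro measurable_compose[OF measurable_component_singleton[of i] h]) auto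
  \<comment> \<open>The joint law of the coordinates is the product measure itself, and its
    marginals are the factors \<open>M i\<close>.\<close>
  have "P.indep_vars M (\<lambda>i x. x i) J"
  proof (subst P.indep_vars_iff_distr_eq_PiM')
    have "distr ?P ?P (\<lambda>x. \<lambda>i\<in>J. x i) = distr ?P ?P (\<lambda>x. x)"
      by (rule distr_cong) (auto simp: space_PiM)
    then show "distr ?P ?P (\<lambda>x. \<lambda>i\<in>J. x i) = PiM J (\<lambda>i. distr ?P (M i) (\<lambda>x. x i))"
      using distr_PiM_component[of J M] M by (simp add: distr_id cong: PiM_cong)
  qed (use J in auto)
  then have "P.indep_vars M (\<lambda>i x. x i) I" using J P.indep_vars_subset by blast
  then have indep: "P.indep_vars (\<lambda>_. borel) (\<lambda>i x. h i (x i)) I"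
    by (rule P.indep_vars_compose2) (use h in auto)
  have E: "P.expectation (\<lambda>x. h i (x i)) = \<mu>" if "i \<in> I" for i
  proof -
    have "P.expectation (\<lambda>x. h i (x i)) = (\<integral>x. h i x \<partial>distr ?P (M i) (\<lambda>x. x i))"
      using that J h by (subst integral_distr) auto
    then show ?thesis using distr_PiM_component[of J M i] M that J mean by auto
  qed
  interpret H: Hoeffding_ineq ?P I "\<lambda>i x. h i (x i)" "\<lambda>_. 0" "\<lambda>_. 1" "n * \<mu>"
  proof unfold_locales
    show "AE x in ?P. h i (x i) \<in> {0..1}" if "i \<in> I" for i
      using that J h01[OF that] by (intro AE_I2) (auto simp: space_PiM PiE_iff subset_iff)
    show "n * \<mu> \<equiv> \<Sum>i\<in>I. P.expectation (\<lambda>x. h i (x i))"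
      using E by (simp add: n_def)
  qed (use fin indep in auto)
  define \<epsilon> where "\<epsilon> = sqrt (ln (2 / \<beta>) / (2 * n))"
  have ln0: "ln (2 / \<beta>) \<ge> 0" using \<beta> by simp
  have \<epsilon>: "\<epsilon> \<ge> 0" "\<epsilon>\<^sup>2 = ln (2 / \<beta>) / (2 * n)" using ln0 n by (simp_all add: \<epsilon>_def)
  have "P.prob {x \<in> space ?P. \<bar>1 / n * (\<Sum>i\<in>I. h i (x i)) - \<mu>\<bar> > \<epsilon>}
      \<le> P.prob {x \<in> space ?P. \<bar>(\<Sum>i\<in>I. h i (x i)) - n * \<mu>\<bar> \<ge> n * \<epsilon>}"
  proof (rule P.finite_measure_mono)
    show "{x \<in> space ?P. \<bar>1 / n * (\<Sum>i\<in>I. h i (x i)) - \<mu>\<bar> > \<epsilon>}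
        \<subseteq> {x \<in> space ?P. \<bar>(\<Sum>i\<in>I. h i (x i)) - n * \<mu>\<bar> \<ge> n * \<epsilon>}"
    proof safe
      fix x assume "\<epsilon> < \<bar>1 / n * (\<Sum>i\<in>I. h i (x i)) - \<mu>\<bar>"
      then have "n * \<epsilon> \<le> \<bar>n\<bar> * \<bar>1 / n * (\<Sum>i\<in>I. h i (x i)) - \<mu>\<bar>" using n by simp
      also have "\<dots> = \<bar>(\<Sum>i\<in>I. h i (x i)) - n * \<mu>\<bar>"
        using n by (simp only: abs_mult[symmetric]) (simp add: right_diff_distrib)
      finally show "n * \<epsilon> \<le> \<bar>(\<Sum>i\<in>I. h i (x i)) - n * \<mu>\<bar>" .
    qed
  qed measurable
  also have "\<dots> \<le> 2 * exp (-2 * (n * \<epsilon>)\<^sup>2 / (\<Sum>i\<in>I. (1 - 0)\<^sup>2))"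
    by (rule H.Hoeffding_ineq_abs_ge) (use n \<epsilon> in \<open>auto simp: n_def\<close>)
  \<comment> \<open>Each summand ranges over an interval of length 1, so the squared lengths sum to
    \<open>n\<close>, and one factor \<open>n\<close> cancels.\<close>
  also have "-2 * (n * \<epsilon>)\<^sup>2 / (\<Sum>i\<in>I. (1 - 0)\<^sup>2) = - ln (2 / \<beta>)"
  proof -
    have "(\<Sum>i\<in>I. (1 - 0::real)\<^sup>2) = n" by (simp add: n_def)
    moreover have "-2 * (n * \<epsilon>)\<^sup>2 / n = - ln (2 / \<beta>)"
      unfolding power_mult_distrib \<epsilon>(2) using n by (simp add: power2_eq_square)
    ultimately show ?thesis by simp
  qed
  also have "2 * exp (- ln (2 / \<beta>)) = \<beta>"
    using \<beta> by (simp add: exp_minus)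
  finally show ?thesis by (simp add: \<epsilon>_def n_def)
qed

section \<open>Disintegration along a conditional law\<close>

text \<open>The parameter is moved from the integrand into the measure: pushing \<open>L x\<close>
  forward along \<open>Pair x\<close> leaves one fixed integrand on the product space and a
  measurable family of measures.\<close>

lemma integral_measurable_subprob_algebra2:
  fixes f :: "'a \<Rightarrow> 'b \<Rightarrow> real"
  assumes f[measurable]: "(\<lambda>(x, y). f x y) \<in> borel_measurable (M \<Otimes>\<^sub>M N)"
    and L[measurable]: "L \<in> M \<rightarrow>\<^sub>M subprob_algebra N"
  shows "(\<lambda>x. \<integral>y. f x y \<partial>L x) \<in> borel_measurable M"
proof (rule measurable_cong[THEN iffD1])
  show "(\<lambda>x. integral\<^sup>L (distr (L x) (M \<Otimes>\<^sub>M N) (Pair x)) (\<lambda>(x, y). f x y)) \<in> borel_measurable M"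
    by (rule measurable_compose[OF measurable_distr2 integral_measurable_subprob_algebra]) measurable
  show "integral\<^sup>L (distr (L x) (M \<Otimes>\<^sub>M N) (Pair x)) (\<lambda>(x, y). f x y) = (\<integral>y. f x y \<partial>L x)"
    if "x \<in> space M" for x
    using that by (subst integral_distr) auto
qed

text \<open>\<open>cond_law_on\<close> tests only rectangles \<open>E \<times> B\<close>. These form
  an intersection-stable generator of the product, so a Dynkin argument reaches all measurable sets
  \<open>W\<close>, in which \<omega> and the draw may be coupled. The kernel is controlled only on
  \<open>D\<close>, hence the restricted spaces; extended nonnegative values let the disjoint unions
  be summed without convergence conditions.\<close>

lemma cond_law_on_emeasure:
  assumes P: "prob_space P" and c: "cond_law_on P F D X N \<kappa>"
    and W: "W \<in> sets (restrict_space F D \<Otimes>\<^sub>M N)"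
  shows "emeasure P {\<omega> \<in> D. (\<omega>, X \<omega>) \<in> W} =
    (\<integral>\<^sup>+\<omega>. emeasure (\<kappa> \<omega>) (Pair \<omega> -` W) \<partial>restrict_space P D)"
proof -
  interpret P: prob_space P by fact
  have F: "sets F \<subseteq> sets P" "space F = space P" and D: "D \<in> sets F" and X[measurable]: "X \<in> P \<rightarrow>\<^sub>M N"
    and \<kappa>: "\<kappa> \<in> restrict_space F D \<rightarrow>\<^sub>M prob_algebra N"
    and law: "\<And>E B. E \<in> sets F \<Longrightarrow> E \<subseteq> D \<Longrightarrow> B \<in> sets N \<Longrightarrow>
        measure P (E \<inter> X -` B) = (\<integral>\<omega>. indicator E \<omega> * measure (\<kappa> \<omega>) B \<partial>P)"
    using c by (auto simp: cond_law_on_def subalgebra_def)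
  have DP: "D \<in> sets P" "D \<subseteq> space P" using D F sets.sets_into_space by (blast, metis)
  have DF: "D \<inter> space F \<in> sets F" using D by (simp add: sets.Int_space_eq2)
  let ?F = "restrict_space F D" and ?P = "restrict_space P D"
  have spF: "space ?F = D" and spP: "space ?P = D" using DP F by (auto simp: space_restrict_space)
  have PF: "sets ?F \<subseteq> sets ?P" using F by (auto simp: sets_restrict_space)
  have toP: "f \<in> ?P \<rightarrow>\<^sub>M L" if "f \<in> ?F \<rightarrow>\<^sub>M L" for f :: "_ \<Rightarrow> 'z" and L :: "'z measure"
    using that PF spF spP by (auto simp: measurable_def)
  have \<kappa>S[measurable]: "\<kappa> \<in> ?F \<rightarrow>\<^sub>M subprob_algebra N" using \<kappa> by (rule measurable_prob_algebraD)
  have \<kappa>sp: "prob_space (\<kappa> \<omega>)" "sets (\<kappa> \<omega>) = sets N" "space (\<kappa> \<omega>) = space N" if "\<omega> \<in> D" for \<omega>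
    using measurable_space[OF \<kappa>, of \<omega>] that spF by (auto simp: space_prob_algebra dest: sets_eq_imp_space_eq)
  have P1: "emeasure ?P D = emeasure P D" using DP by (subst emeasure_restrict_space) auto
  have meas: "(\<lambda>\<omega>. emeasure (\<kappa> \<omega>) (Pair \<omega> -` W)) \<in> borel_measurable ?P" if "W \<in> sets (?F \<Otimes>\<^sub>M N)" for W
  proof (rule toP, rule emeasure_measurable_subprob_algebra2[OF _ \<kappa>S])
    have "W \<subseteq> space ?F \<times> space N" using sets.sets_into_space[OF that] by (simp add: space_pair_measure)
    then have "(SIGMA x:space ?F. Pair x -` W) = W" by auto
    then show "(SIGMA x:space ?F. Pair x -` W) \<in> sets (?F \<Otimes>\<^sub>M N)" using that by simp
  qed
  have EP: "{\<omega> \<in> D. (\<omega>, X \<omega>) \<in> W} \<in> sets P" if "W \<in> sets (?F \<Otimes>\<^sub>M N)" for W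
  proof -
    have "(\<lambda>\<omega>. (\<omega>, X \<omega>)) \<in> ?P \<rightarrow>\<^sub>M ?F \<Otimes>\<^sub>M N"
      by (rule measurable_Pair[OF toP[OF measurable_ident_sets[OF refl]] measurable_restrict_space1[OF X]])
    from measurable_sets[OF this that] have "(\<lambda>\<omega>. (\<omega>, X \<omega>)) -` W \<inter> D \<in> sets P"
      using DP spP by (auto simp: sets_restrict_space_iff)
    then show ?thesis by (auto simp: vimage_def Int_def conj_commute)
  qed
  show ?thesis
    using Int_stable_pair_measure_generator pair_measure_closed W unfolding sets_pair_measure
  proof (induct W rule: sigma_sets_induct_disjoint)
    case (basic W)
    then obtain E B where E: "E \<in> sets ?F" and B: "B \<in> sets N" and W: "W = E \<times> B" by auto
    have E': "E \<in> sets F" "E \<subseteq> D" using E DF by (auto simp: sets_restrict_space_iff)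
    have "{\<omega> \<in> D. (\<omega>, X \<omega>) \<in> W} = E \<inter> X -` B" using E' W by auto
    then have "emeasure P {\<omega> \<in> D. (\<omega>, X \<omega>) \<in> W} = ennreal (\<integral>\<omega>. indicator E \<omega> * measure (\<kappa> \<omega>) B \<partial>P)"
      using law[OF E' B] by (simp add: P.emeasure_eq_measure)
    also have "\<dots> = (\<integral>\<^sup>+\<omega>. ennreal (indicator E \<omega> * measure (\<kappa> \<omega>) B) \<partial>P)"
    proof (rule nn_integral_eq_integral[symmetric])
      \<comment> \<open>Off \<open>D\<close> nothing is known about \<open>\<kappa>\<close>.
        Multiplying by the indicator of \<open>D\<close> gives a function measurable on all of
        \<open>P\<close>, and the indicator is absorbed because
        \<open>E \<subseteq> D\<close>.\<close>
      have "(\<lambda>\<omega>. measure (\<kappa> \<omega>) B) \<in> borel_measurable ?P"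
        by (rule toP, rule measurable_compose[OF \<kappa> measurable_measure_prob_algebra[OF B]])
      then have "(\<lambda>\<omega>. indicator D \<omega> *\<^sub>R measure (\<kappa> \<omega>) B) \<in> borel_measurable P"
        using DP by (subst borel_measurable_restrict_space_iff[symmetric]) auto
      then have "(\<lambda>\<omega>. indicator E \<omega> * (indicator D \<omega> *\<^sub>R measure (\<kappa> \<omega>) B)) \<in> borel_measurable P"
        using E' F by (intro borel_measurable_times) auto
      also have "(\<lambda>\<omega>. indicator E \<omega> * (indicator D \<omega> *\<^sub>R measure (\<kappa> \<omega>) B)) = (\<lambda>\<omega>. indicator E \<omega> * measure (\<kappa> \<omega>) B)"
        using E' by (auto simp: fun_eq_iff split: split_indicator)
      finally show "integrable P (\<lambda>\<omega>. indicator E \<omega> * measure (\<kappa> \<omega>) B)"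
        using E' prob_space.prob_le_1[OF \<kappa>sp(1)]
        by (intro P.integrable_const_bound[where B=1] AE_I2) (auto split: split_indicator)
    qed (auto split: split_indicator)
    also have "\<dots> = (\<integral>\<^sup>+\<omega>. emeasure (\<kappa> \<omega>) (Pair \<omega> -` W) * indicator D \<omega> \<partial>P)"
      using E' \<kappa>sp(1) W by (intro nn_integral_cong)
        (auto split: split_indicator simp: finite_measure.emeasure_eq_measure[OF prob_space.finite_measure])
    also have "\<dots> = (\<integral>\<^sup>+\<omega>. emeasure (\<kappa> \<omega>) (Pair \<omega> -` W) \<partial>?P)"
      using DP by (subst nn_integral_restrict_space) auto
    finally show ?case .
  next
    case empty then show ?case by simp
  next
    case (compl W)
    then have W: "W \<in> sets (?F \<Otimes>\<^sub>M N)" by (simp add: sets_pair_measure)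
    let ?E = "{\<omega> \<in> D. (\<omega>, X \<omega>) \<in> W}"
    have "{\<omega> \<in> D. (\<omega>, X \<omega>) \<in> space ?F \<times> space N - W} = D - ?E"
      using spF measurable_space[OF X] DP by auto
    then have "emeasure P {\<omega> \<in> D. (\<omega>, X \<omega>) \<in> space ?F \<times> space N - W} = emeasure P D - emeasure P ?E"
      using EP[OF W] DP by (simp add: emeasure_Diff)
    also have "\<dots> = (\<integral>\<^sup>+\<omega>. 1 \<partial>?P) - (\<integral>\<^sup>+\<omega>. emeasure (\<kappa> \<omega>) (Pair \<omega> -` W) \<partial>?P)"
      using compl P1 spP by simp
    also have "\<dots> = (\<integral>\<^sup>+\<omega>. 1 - emeasure (\<kappa> \<omega>) (Pair \<omega> -` W) \<partial>?P)"
    proof (rule nn_integral_diff[symmetric])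
      show "(\<integral>\<^sup>+\<omega>. emeasure (\<kappa> \<omega>) (Pair \<omega> -` W) \<partial>?P) \<noteq> \<infinity>"
        \<comment> \<open>By the induction hypothesis this integral is a probability, hence finite,
          as subtraction in \<open>ennreal\<close> requires.\<close>
        unfolding compl(2)[symmetric] by simp
      show "AE \<omega> in ?P. emeasure (\<kappa> \<omega>) (Pair \<omega> -` W) \<le> 1"
        using prob_space.emeasure_le_1[OF \<kappa>sp(1)] spP by (intro AE_I2) auto
      show "(\<lambda>\<omega>. emeasure (\<kappa> \<omega>) (Pair \<omega> -` W)) \<in> borel_measurable ?P" by (rule meas[OF W])
    qed simp
    also have "\<dots> = (\<integral>\<^sup>+\<omega>. emeasure (\<kappa> \<omega>) (Pair \<omega> -` (space ?F \<times> space N - W)) \<partial>?P)"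
    proof (rule nn_integral_cong)
      fix \<omega> assume "\<omega> \<in> space ?P"
      then have w: "\<omega> \<in> D" using spP by simp
      have s: "Pair \<omega> -` W \<in> sets (\<kappa> \<omega>)" using sets_Pair1[OF W] \<kappa>sp w by simp
      have "Pair \<omega> -` (space ?F \<times> space N - W) = space (\<kappa> \<omega>) - Pair \<omega> -` W"
        using w spF \<kappa>sp by auto
      then show "1 - emeasure (\<kappa> \<omega>) (Pair \<omega> -` W) = emeasure (\<kappa> \<omega>) (Pair \<omega> -` (space ?F \<times> space N - W))"
        using s \<kappa>sp(1)[OF w]
        by (simp add: emeasure_compl prob_space.emeasure_space_1 finite_measure.emeasure_finite[OF prob_space.finite_measure])
    qed
    finally show ?case .
  next
    case (union W)
    then have W: "range W \<subseteq> sets (?F \<Otimes>\<^sub>M N)" by (simp add: sets_pair_measure)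
    have "{\<omega> \<in> D. (\<omega>, X \<omega>) \<in> (\<Union>i. W i)} = (\<Union>i. {\<omega> \<in> D. (\<omega>, X \<omega>) \<in> W i})" by auto
    then have "emeasure P {\<omega> \<in> D. (\<omega>, X \<omega>) \<in> (\<Union>i. W i)} = (\<Sum>i. emeasure P {\<omega> \<in> D. (\<omega>, X \<omega>) \<in> W i})"
    proof (simp only:, intro suminf_emeasure[symmetric])
      show "range (\<lambda>i. {\<omega> \<in> D. (\<omega>, X \<omega>) \<in> W i}) \<subseteq> sets P" using W EP by auto
      show "disjoint_family (\<lambda>i. {\<omega> \<in> D. (\<omega>, X \<omega>) \<in> W i})"
        using union(1) unfolding disjoint_family_on_def by blast
    qed
    also have "\<dots> = (\<Sum>i. \<integral>\<^sup>+\<omega>. emeasure (\<kappa> \<omega>) (Pair \<omega> -` W i) \<partial>?P)" using union(3) by simp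
    also have "\<dots> = (\<integral>\<^sup>+\<omega>. (\<Sum>i. emeasure (\<kappa> \<omega>) (Pair \<omega> -` W i)) \<partial>?P)"
      using W meas by (intro nn_integral_suminf[symmetric]) auto
    also have "\<dots> = (\<integral>\<^sup>+\<omega>. emeasure (\<kappa> \<omega>) (Pair \<omega> -` (\<Union>i. W i)) \<partial>?P)"
    proof (rule nn_integral_cong)
      fix \<omega> assume "\<omega> \<in> space ?P"
      then have w: "\<omega> \<in> D" using spP by simp
      have "Pair \<omega> -` W i \<in> sets (\<kappa> \<omega>)" for i using sets_Pair1[of "W i"] W \<kappa>sp w by auto
      then have "(\<Sum>i. emeasure (\<kappa> \<omega>) (Pair \<omega> -` W i)) = emeasure (\<kappa> \<omega>) (\<Union>i. Pair \<omega> -` W i)"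
        using union(1) by (intro suminf_emeasure) (auto simp: disjoint_family_on_def)
      then show "(\<Sum>i. emeasure (\<kappa> \<omega>) (Pair \<omega> -` W i)) = emeasure (\<kappa> \<omega>) (Pair \<omega> -` (\<Union>i. W i))"
        by (simp add: vimage_UN)
    qed
    finally show ?case .
  qed
qed

text \<open>A uniform bound on the sections is integrated over \<open>D\<close>. The factor
  \<open>measure P D\<close> is kept so that bounds over disjoint conditioning events can be
  summed.\<close>

lemma cond_law_on_measure_le:
  assumes P: "prob_space P" and c: "cond_law_on P F D X N \<kappa>"
    and W: "W \<in> sets (restrict_space F D \<Otimes>\<^sub>M N)"
    and le: "\<And>\<omega>. \<omega> \<in> D \<Longrightarrow> measure (\<kappa> \<omega>) (Pair \<omega> -` W) \<le> b" and b: "0 \<le> b"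
  shows "measure P {\<omega> \<in> D. (\<omega>, X \<omega>) \<in> W} \<le> b * measure P D"
proof -
  interpret P: prob_space P by fact
  have F: "sets F \<subseteq> sets P" "space F = space P" and D: "D \<in> sets F"
    and \<kappa>: "\<kappa> \<in> restrict_space F D \<rightarrow>\<^sub>M prob_algebra N"
    using c by (auto simp: cond_law_on_def subalgebra_def)
  have DP: "D \<in> sets P" "D \<subseteq> space P" using D F sets.sets_into_space by (blast, metis)
  have sp: "space (restrict_space P D) = D" "space (restrict_space F D) = D"
    using DP F by (auto simp: space_restrict_space)
  have "emeasure P {\<omega> \<in> D. (\<omega>, X \<omega>) \<in> W} \<le> (\<integral>\<^sup>+\<omega>. ennreal b \<partial>restrict_space P D)"
    unfolding cond_law_on_emeasure[OF P c W]
  proof (rule nn_integral_mono)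
    fix \<omega> assume "\<omega> \<in> space (restrict_space P D)"
    then have w: "\<omega> \<in> D" using sp by simp
    then have "finite_measure (\<kappa> \<omega>)"
      using measurable_space[OF \<kappa>, of \<omega>] sp by (auto simp: space_prob_algebra prob_space_def)
    then show "emeasure (\<kappa> \<omega>) (Pair \<omega> -` W) \<le> ennreal b"
      using le[OF w] by (simp add: finite_measure.emeasure_eq_measure ennreal_leI)
  qed
  also have "\<dots> = ennreal (b * measure P D)"
    using DP b sp by (simp add: emeasure_restrict_space P.emeasure_eq_measure ennreal_mult)
  finally show ?thesis using b by (simp add: P.emeasure_eq_measure)
qed

section \<open>Values and failure distributions\<close>

locale agent_setting =
  fixes S :: "('t, 'o, 'c) setting"
  assumes valid: "valid_setting S"
begin

abbreviation "T \<equiv> task_space S"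
abbreviation "Out \<equiv> output_space S"
abbreviation "Ag \<equiv> agent_space S"
abbreviation "D \<equiv> user_dist S"

lemma prob_user: "prob_space D"
  and sets_user[measurable_cong, simp]: "sets D = sets T"
  and kernel_measurable[measurable]: "(\<lambda>(A, t). A t) \<in> Ag \<Otimes>\<^sub>M T \<rightarrow>\<^sub>M prob_algebra Out"
  and oplus_measurable: "(\<lambda>(A, c). oplus S A c) \<in> Ag \<Otimes>\<^sub>M mod_space S \<rightarrow>\<^sub>M Ag"
  and reward_measurable[measurable]: "(\<lambda>(t, y). reward S t y) \<in> borel_measurable (T \<Otimes>\<^sub>M Out)"
  and reward_01: "\<And>t y. t \<in> space T \<Longrightarrow> y \<in> space Out \<Longrightarrow> reward S t y \<in> {0..1}"
  and detector_measurable[measurable]: "(\<lambda>(t, y). detector S t y) \<in> T \<Otimes>\<^sub>M Out \<rightarrow>\<^sub>M count_space UNIV"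
  using valid by (auto simp: valid_setting_def)

lemma space_user[simp]: "space D = space T"
  using sets_user by (rule sets_eq_imp_space_eq)

sublocale U: prob_space D by (rule prob_user)

lemma agent_prob:
  assumes "A \<in> space Ag" "t \<in> space T"
  shows "prob_space (A t)" "sets (A t) = sets Out" "space (A t) = space Out"
  using measurable_space[OF kernel_measurable, of "(A, t)"] assms
  by (auto simp: space_pair_measure space_prob_algebra dest: sets_eq_imp_space_eq)

text \<open>Agents are random during a run, so values and failure probabilities have to be
  measurable jointly in agent and task. This is where joint measurability of the evaluation map is
  used.\<close>

lemma kernel_integral_measurable:
  fixes g :: "'t \<Rightarrow> 'o \<Rightarrow> real"
  assumes g[measurable]: "(\<lambda>(t, y). g t y) \<in> borel_measurable (T \<Otimes>\<^sub>M Out)"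
  shows "(\<lambda>(A, t). \<integral>y. g t y \<partial>A t) \<in> borel_measurable (Ag \<Otimes>\<^sub>M T)"
proof -
  have L: "(\<lambda>p. fst p (snd p)) \<in> Ag \<Otimes>\<^sub>M T \<rightarrow>\<^sub>M subprob_algebra Out"
    using measurable_prob_algebraD[OF kernel_measurable] by (simp add: case_prod_unfold)
  have "(\<lambda>p. \<integral>y. g (snd p) y \<partial>fst p (snd p)) \<in> borel_measurable (Ag \<Otimes>\<^sub>M T)"
    by (rule integral_measurable_subprob_algebra2[OF _ L]) measurable
  then show ?thesis by (simp add: case_prod_unfold)
qed

lemma kernel_integral_01:
  fixes g :: "'t \<Rightarrow> 'o \<Rightarrow> real"
  assumes A: "A \<in> space Ag" and t: "t \<in> space T"
    and gm: "(\<lambda>(t, y). g t y) \<in> borel_measurable (T \<Otimes>\<^sub>M Out)"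
    and g: "\<And>y. y \<in> space Out \<Longrightarrow> g t y \<in> {0..1}"
  shows "(\<integral>y. g t y \<partial>A t) \<in> {0..1}"
proof -
  interpret A: prob_space "A t" using agent_prob[OF A t] by simp
  have "g t \<in> borel_measurable (A t)"
    using measurable_Pair2[OF gm t] by (simp add: measurable_cong_sets[OF agent_prob(2)[OF A t]])
  then have i: "integrable (A t) (g t)"
    using g agent_prob[OF A t] by (intro A.integrable_const_bound[where B = 1]) auto
  have "0 \<le> (\<integral>y. g t y \<partial>A t)"
    using g agent_prob[OF A t] by (intro Bochner_Integration.integral_nonneg) auto
  moreover have "(\<integral>y. g t y \<partial>A t) \<le> 1"
    using g agent_prob[OF A t] i by (intro A.integral_le_const) auto
  ultimately show ?thesis by simp
qed

lemma V_measurable[measurable (raw)]: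
  assumes [measurable]: "A \<in> M \<rightarrow>\<^sub>M Ag" "t \<in> M \<rightarrow>\<^sub>M T"
  shows "(\<lambda>x. V S (A x) (t x)) \<in> borel_measurable M"
proof -
  have "(\<lambda>(A, t). V S A t) \<in> borel_measurable (Ag \<Otimes>\<^sub>M T)"
    unfolding V_def by (rule kernel_integral_measurable) measurable
  from measurable_compose[OF measurable_Pair[OF assms] this] show ?thesis by simp
qed

lemma psi_measurable[measurable (raw)]:
  assumes [measurable]: "A \<in> M \<rightarrow>\<^sub>M Ag" "t \<in> M \<rightarrow>\<^sub>M T"
  shows "(\<lambda>x. psi S (A x) (t x)) \<in> borel_measurable M"
proof -
  have "(\<lambda>(A, t). psi S A t) \<in> borel_measurable (Ag \<Otimes>\<^sub>M T)"
    unfolding psi_def by (rule kernel_integral_measurable) measurable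
  from measurable_compose[OF measurable_Pair[OF assms] this] show ?thesis by simp
qed

lemma Adv_measurable[measurable (raw)]:
  assumes [measurable]: "A \<in> M \<rightarrow>\<^sub>M Ag" "A' \<in> M \<rightarrow>\<^sub>M Ag" "t \<in> M \<rightarrow>\<^sub>M T"
  shows "(\<lambda>x. Adv S (A x) (A' x) (t x)) \<in> borel_measurable M"
  unfolding Adv_def by measurable

lemma reward_measurable'[measurable (raw)]:
  assumes [measurable]: "t \<in> M \<rightarrow>\<^sub>M T" "y \<in> M \<rightarrow>\<^sub>M Out"
  shows "(\<lambda>x. reward S (t x) (y x)) \<in> borel_measurable M"
  using measurable_compose[OF measurable_Pair[OF assms] reward_measurable] by simp

lemma V_01: "A \<in> space Ag \<Longrightarrow> t \<in> space T \<Longrightarrow> V S A t \<in> {0..1}"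
  unfolding V_def by (rule kernel_integral_01) (use reward_01 reward_measurable in auto)

lemma psi_01: "A \<in> space Ag \<Longrightarrow> t \<in> space T \<Longrightarrow> psi S A t \<in> {0..1}"
  unfolding psi_def
proof (rule kernel_integral_01)
  show "(\<lambda>(t, y). of_bool (detector S t y) :: real) \<in> borel_measurable (T \<Otimes>\<^sub>M Out)" by measurable
qed auto

lemma abs_Adv_le_1: "A \<in> space Ag \<Longrightarrow> A' \<in> space Ag \<Longrightarrow> t \<in> space T \<Longrightarrow> \<bar>Adv S A A' t\<bar> \<le> 1"
  using V_01[of A t] V_01[of A' t] by (auto simp: Adv_def)

lemma V_measurable1: "A \<in> space Ag \<Longrightarrow> V S A \<in> borel_measurable T"
  and psi_measurable1: "A \<in> space Ag \<Longrightarrow> psi S A \<in> borel_measurable T"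
  and Adv_measurable1: "A \<in> space Ag \<Longrightarrow> A' \<in> space Ag \<Longrightarrow> Adv S A A' \<in> borel_measurable T"
  using V_measurable[of "\<lambda>_. A" T "\<lambda>t. t"] psi_measurable[of "\<lambda>_. A" T "\<lambda>t. t"]
    Adv_measurable[of "\<lambda>_. A" T "\<lambda>_. A'" "\<lambda>t. t"] by simp_all

lemma integrable_user:
  fixes f :: "'t \<Rightarrow> real"
  assumes "f \<in> borel_measurable T" "\<And>t. t \<in> space T \<Longrightarrow> \<bar>f t\<bar> \<le> 1"
  shows "integrable D f"
  using assms by (intro U.integrable_const_bound[where B = 1]) (auto simp: measurable_cong_sets[OF sets_user])

lemma J_measurable[measurable]: "J_user S \<in> borel_measurable Ag"
  unfolding J_user_def[abs_def] by (rule U.borel_measurable_lebesgue_integral) measurable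

lemma Z_measurable[measurable]: "Z S \<in> borel_measurable Ag"
  unfolding Z_def[abs_def] by (rule U.borel_measurable_lebesgue_integral) measurable

lemma Z_01: assumes A: "A \<in> space Ag" shows "Z S A \<in> {0..1}"
proof -
  have "0 \<le> Z S A"
    unfolding Z_def using psi_01[OF A] by (intro Bochner_Integration.integral_nonneg) auto
  moreover have "Z S A \<le> 1"
    unfolding Z_def using psi_01[OF A] psi_measurable1[OF A]
    by (intro U.integral_le_const integrable_user) auto
  ultimately show ?thesis by simp
qed

lemma Z_times_D_F_integral:
  assumes A: "A \<in> space Ag" and f: "f \<in> borel_measurable T"
  shows "Z S A * (\<integral>t. f t \<partial>D_F S A) = (\<integral>t. psi S A t * f t \<partial>D)"
proof -
  have psi: "psi S A \<in> borel_measurable D" using psi_measurable1[OF A] by simp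
  have "(\<integral>t. f t \<partial>D_F S A) = (\<integral>t. psi S A t / Z S A * f t \<partial>D)"
    unfolding D_F_def using f psi psi_01[OF A] Z_01[OF A]
    by (subst integral_real_density) auto
  also have "Z S A * \<dots> = (\<integral>t. Z S A * (psi S A t / Z S A * f t) \<partial>D)" by simp
  also have "\<dots> = (\<integral>t. psi S A t * f t \<partial>D)"
  proof (cases "Z S A = 0")
    \<comment> \<open>When \<open>Z\<close> vanishes, the nonnegative function \<open>psi\<close>
      vanishes almost everywhere, so the right side is 0 as well.\<close>
    case True
    then have "AE t in D. psi S A t = 0"
      unfolding Z_def using psi_01[OF A] psi_measurable1[OF A]
      by (subst (asm) integral_nonneg_eq_0_iff_AE) (auto intro!: integrable_user)
    then have "(\<integral>t. psi S A t * f t \<partial>D) = (\<integral>t. 0 \<partial>D)"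
      using f psi by (intro integral_cong_AE) auto
    then show ?thesis using True by simp
  qed simp
  finally show ?thesis .
qed

text \<open>The measure of integration itself varies with the agent. Writing out its density moves
  this dependence into the integrand over the fixed measure \<open>D\<close>. The deviation event of
  the failure batch needs this to be measurable.\<close>

lemma D_F_Adv_integral_measurable:
  "(\<lambda>(A, A'). \<integral>t. Adv S A A' t \<partial>D_F S A) \<in> borel_measurable (Ag \<Otimes>\<^sub>M Ag)"
proof (rule measurable_cong[THEN iffD1])
  show "(\<lambda>(A, A'). \<integral>t. psi S A t / Z S A * Adv S A A' t \<partial>D) \<in> borel_measurable (Ag \<Otimes>\<^sub>M Ag)"
    unfolding case_prod_unfold by (rule U.borel_measurable_lebesgue_integral) measurable
  fix p assume "p \<in> space (Ag \<Otimes>\<^sub>M Ag)"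
  then obtain A A' where p: "p = (A, A')" "A \<in> space Ag" "A' \<in> space Ag" by (auto simp: space_pair_measure)
  then show "(case p of (A, A') \<Rightarrow> \<integral>t. psi S A t / Z S A * Adv S A A' t \<partial>D) =
      (case p of (A, A') \<Rightarrow> \<integral>t. Adv S A A' t \<partial>D_F S A)"
    unfolding D_F_def using psi_01 Z_01 psi_measurable1[OF p(2)] Adv_measurable1[OF p(2,3)]
    by (simp, subst integral_real_density) auto
qed

text \<open>The integrand of the gain is split with the weights \<open>psi\<close> and
  \<open>1 - psi\<close>; normalising the first weight by \<open>Z\<close> produces
  \<open>D_F\<close>. Everything is bounded by 1, so the two parts are integrable
  separately.\<close>

lemma J_diff:
  assumes A: "A \<in> space Ag" and A': "A' \<in> space Ag"
  shows "J_user S A' - J_user S A =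
    Z S A * (\<integral>t. Adv S A A' t \<partial>D_F S A) + (\<integral>t. (1 - psi S A t) * Adv S A A' t \<partial>D)"
proof -
  have i: "integrable D (V S A)" "integrable D (V S A')"
    using V_01 V_measurable1 A A' by (auto intro!: integrable_user)
  have m: "psi S A \<in> borel_measurable T" "Adv S A A' \<in> borel_measurable T"
    using psi_measurable1 Adv_measurable1 A A' by auto
  have b: "\<bar>psi S A t\<bar> \<le> 1" "\<bar>1 - psi S A t\<bar> \<le> 1" "\<bar>Adv S A A' t\<bar> \<le> 1" if "t \<in> space T" for t
    using psi_01[OF A that] abs_Adv_le_1[OF A A' that] by auto
  have "integrable D (\<lambda>t. psi S A t * Adv S A A' t)" "integrable D (\<lambda>t. (1 - psi S A t) * Adv S A A' t)"
    using m b by (auto intro!: integrable_user mult_le_one simp: abs_mult)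
  then have "(\<integral>t. psi S A t * Adv S A A' t \<partial>D) + (\<integral>t. (1 - psi S A t) * Adv S A A' t \<partial>D)
      = (\<integral>t. psi S A t * Adv S A A' t + (1 - psi S A t) * Adv S A A' t \<partial>D)" by simp
  also have "\<dots> = (\<integral>t. V S A' t - V S A t \<partial>D)"
    by (rule Bochner_Integration.integral_cong) (auto simp: Adv_def algebra_simps)
  also have "\<dots> = J_user S A' - J_user S A" using i by (simp add: J_user_def)
  finally show ?thesis using Z_times_D_F_integral[OF A m(2)] by simp
qed

section \<open>The law of a labelled record\<close>

text \<open>The bind in \<open>record_law\<close> is a mixture only if its kernel is measurable. A
  Bernoulli law gives every set of labels a mass that is affine in \<open>psi\<close>, which settles
  this.\<close>

lemma record_kernel_measurable:
  assumes A: "A \<in> space Ag"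
  shows "(\<lambda>t. distr (measure_pmf (bernoulli_pmf (psi S A t))) (record_space S) (Pair t))
    \<in> T \<rightarrow>\<^sub>M prob_algebra (record_space S)"
proof (rule measurable_distr_prob_space2)
  show "(\<lambda>t. measure_pmf (bernoulli_pmf (psi S A t))) \<in> T \<rightarrow>\<^sub>M prob_algebra (count_space UNIV)"
  proof (rule measurable_prob_algebraI[OF measure_pmf.prob_space_axioms], rule measurable_subprob_algebra)
    fix B :: "bool set"
    have "(\<lambda>t. ennreal (psi S A t * indicator B True + (1 - psi S A t) * indicator B False)) \<in> borel_measurable T"
      using psi_measurable1[OF A] by measurable
    moreover have "emeasure (measure_pmf (bernoulli_pmf (psi S A t))) B =
        ennreal (psi S A t * indicator B True + (1 - psi S A t) * indicator B False)" if "t \<in> space T" for t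
    proof -
      have "measure_pmf.prob (bernoulli_pmf (psi S A t)) B =
          (\<integral>b. indicator B b \<partial>measure_pmf (bernoulli_pmf (psi S A t)))" by simp
      also have "\<dots> = psi S A t * indicator B True + (1 - psi S A t) * indicator B False"
        using psi_01[OF A that] by (subst integral_bernoulli_pmf) auto
      finally show ?thesis by (simp add: measure_pmf.emeasure_eq_measure)
    qed
    ultimately show "(\<lambda>t. emeasure (measure_pmf (bernoulli_pmf (psi S A t))) B) \<in> borel_measurable T"
      by (simp cong: measurable_cong)
  qed (auto intro: measure_pmf.subprob_space_axioms)
  show "(\<lambda>(x, y). (x, y)) \<in> T \<Otimes>\<^sub>M count_space UNIV \<rightarrow>\<^sub>M record_space S"
    by (simp add: record_space_def)
qed

lemma record_law_props:
  assumes A: "A \<in> space Ag"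
  shows "prob_space (record_law S A)" "sets (record_law S A) = sets (record_space S)"
    "space (record_law S A) = space T \<times> UNIV"
proof -
  have D: "D \<in> space (prob_algebra T)" using prob_user by (simp add: space_prob_algebra)
  show "prob_space (record_law S A)" unfolding record_law_def
    by (rule prob_space_bind'[OF D record_kernel_measurable[OF A]])
  show s: "sets (record_law S A) = sets (record_space S)" unfolding record_law_def
    by (rule sets_bind'[OF D record_kernel_measurable[OF A]])
  show "space (record_law S A) = space T \<times> UNIV"
    using sets_eq_imp_space_eq[OF s] by (simp add: record_space_def space_pair_measure)
qed

text \<open>Integrating out the label weights the marked value by \<open>psi\<close> and the
  unmarked one by \<open>1 - psi\<close>. So the label itself has mean \<open>Z\<close>, and the
  indicator of an unmarked record times the absolute advantage has the retained loss as its
  mean.\<close>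

lemma integral_record_law:
  fixes g :: "'t \<times> bool \<Rightarrow> real"
  assumes A: "A \<in> space Ag" and g[measurable]: "g \<in> borel_measurable (record_space S)"
    and b: "\<And>t b. t \<in> space T \<Longrightarrow> \<bar>g (t, b)\<bar> \<le> 1"
  shows "(\<integral>x. g x \<partial>record_law S A) = (\<integral>t. psi S A t * g (t, True) + (1 - psi S A t) * g (t, False) \<partial>D)"
proof -
  let ?k = "\<lambda>t. distr (measure_pmf (bernoulli_pmf (psi S A t))) (record_space S) (Pair t)"
  have k: "?k \<in> D \<rightarrow>\<^sub>M subprob_algebra (record_space S)"
    using measurable_prob_algebraD[OF record_kernel_measurable[OF A]] by simp
  have "(\<integral>x. g x \<partial>record_law S A) = (\<integral>t. \<integral>x. g x \<partial>?k t \<partial>D)"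
    unfolding record_law_def
  proof (rule integral_bind[OF g _ k, where B = 1 and B' = 1])
    show "\<bar>g x\<bar> \<le> 1" if "x \<in> space (record_space S)" for x
      using that b by (cases x) (auto simp: record_space_def space_pair_measure)
    show "AE t in D. emeasure (?k t) (space (?k t)) \<le> ennreal 1"
      using subprob_space_kernel[OF k] by (intro AE_I2) (simp add: subprob_space.subprob_emeasure_le_1)
  qed unfold_locales
  also have "\<dots> = (\<integral>t. psi S A t * g (t, True) + (1 - psi S A t) * g (t, False) \<partial>D)"
  proof (rule Bochner_Integration.integral_cong[OF refl])
    fix t assume "t \<in> space D"
    then have t: "t \<in> space T" by simp
    have gm: "g \<in> borel_measurable (T \<Otimes>\<^sub>M count_space UNIV)" using g by (simp add: record_space_def)
    have "(\<integral>x. g x \<partial>?k t) = (\<integral>b. g (t, b) \<partial>measure_pmf (bernoulli_pmf (psi S A t)))"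
      using t gm by (subst integral_distr) (auto simp: record_space_def space_pair_measure)
    also have "\<dots> = psi S A t * g (t, True) + (1 - psi S A t) * g (t, False)"
      using psi_01[OF A t] by (subst integral_bernoulli_pmf) auto
    finally show "(\<integral>x. g x \<partial>?k t) = psi S A t * g (t, True) + (1 - psi S A t) * g (t, False)" .
  qed
  finally show ?thesis .
qed

end

section \<open>Measurability along a run\<close>

lemma None_in_sets_option_space: "{None} \<in> sets (option_space M)"
  and space_option_space: "space (option_space M) = insert None (Some ` space M)"
  and Some_image_in_sets_option_space: "B \<in> sets M \<Longrightarrow> Some ` B \<in> sets (option_space M)"
proof -
  have g: "insert {None} ((\<lambda>B. Some ` B) ` sets M) \<subseteq> Pow (insert None (Some ` space M))"
    using sets.sets_into_space by fastforce
  show "{None} \<in> sets (option_space M)" "B \<in> sets M \<Longrightarrow> Some ` B \<in> sets (option_space M)"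
    unfolding option_space_def using g by (auto simp: sets_measure_of)
  show "space (option_space M) = insert None (Some ` space M)"
    unfolding option_space_def using g by (rule space_measure_of)
qed

text \<open>\<open>the\<close> is under control only away from \<open>None\<close>, so the domain is
  cut along the measurable event \<open>g x = None\<close> and each part is treated on its
  own.\<close>

lemma (in agent_setting) oplus_option_measurable:
  assumes A: "A \<in> M \<rightarrow>\<^sub>M Ag" and g: "g \<in> M \<rightarrow>\<^sub>M option_space (mod_space S)"
  shows "(\<lambda>x. if g x = None then A x else oplus S (A x) (the (g x))) \<in> M \<rightarrow>\<^sub>M Ag"
proof (subst measurable_If_restrict_space_iff)
  show N: "{x \<in> space M. g x = None} \<in> sets M"
    using measurable_sets[OF g None_in_sets_option_space] by (simp add: vimage_def Int_def conj_commute)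
  let ?M = "restrict_space M {x. g x \<noteq> None}"
  have sub: "{x. g x \<noteq> None} \<inter> space M \<in> sets M"
  proof -
    have "{x. g x \<noteq> None} \<inter> space M = space M - {x \<in> space M. g x = None}" by auto
    then show ?thesis using sets.compl_sets[OF N] by simp
  qed
  have "(\<lambda>x. the (g x)) \<in> ?M \<rightarrow>\<^sub>M mod_space S"
  proof (rule measurableI)
    show "the (g x) \<in> space (mod_space S)" if "x \<in> space ?M" for x
      using that measurable_space[OF g, of x] by (auto simp: space_restrict_space space_option_space)
    fix B assume B: "B \<in> sets (mod_space S)"
    have "(\<lambda>x. the (g x)) -` B \<inter> space ?M = g -` (Some ` B) \<inter> space M"
      by (auto simp: space_restrict_space)
    moreover have "g -` (Some ` B) \<inter> space M \<in> sets M"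
      using measurable_sets[OF g Some_image_in_sets_option_space[OF B]] .
    ultimately show "(\<lambda>x. the (g x)) -` B \<inter> space ?M \<in> sets ?M"
      unfolding sets_restrict_space_iff[OF sub] by auto
  qed
  from measurable_compose[OF measurable_Pair[OF measurable_restrict_space1[OF A] this] oplus_measurable]
  show "A \<in> restrict_space M {x. g x = None} \<rightarrow>\<^sub>M Ag \<and>
      (\<lambda>x. oplus S (A x) (the (g x))) \<in> restrict_space M {x. g x \<noteq> None} \<rightarrow>\<^sub>M Ag"
    using measurable_restrict_space1[OF A] by simp
qed

lemma filter_measurable:
  assumes "\<And>n. n \<in> set xs \<Longrightarrow> Measurable.pred M (Q n)"
  shows "(\<lambda>x. filter (\<lambda>n. Q n x) xs) \<in> M \<rightarrow>\<^sub>M count_space UNIV"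
  using assms
proof (induction xs)
  case (Cons n xs)
  have [measurable]: "(\<lambda>x. filter (\<lambda>n. Q n x) xs) \<in> M \<rightarrow>\<^sub>M count_space UNIV"
    and [measurable]: "Measurable.pred M (Q n)" using Cons by auto
  have "(\<lambda>x. n # filter (\<lambda>n. Q n x) xs) \<in> M \<rightarrow>\<^sub>M count_space UNIV"
    by (rule measurable_compose[where N="count_space UNIV" and g="\<lambda>ys. n # ys"]) auto
  then show ?case by simp measurable
qed simp

text \<open>The supremum is taken in the reals and is informative only over a bounded set; two
  probabilities differ by at most 1.\<close>

lemma total_variation_bound:
  assumes "prob_space M" "prob_space N" and B: "B \<in> sets M"
  shows "measure M B \<le> measure N B + total_variation M N" "0 \<le> total_variation M N"
proof -
  have bdd: "bdd_above ((\<lambda>B. \<bar>measure M B - measure N B\<bar>) ` sets M)"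
  proof (rule bdd_aboveI2)
    fix B show "\<bar>measure M B - measure N B\<bar> \<le> 1"
      using prob_space.prob_le_1[OF assms(1), of B] prob_space.prob_le_1[OF assms(2), of B]
        measure_nonneg[of M B] measure_nonneg[of N B] by linarith
  qed
  have le: "\<bar>measure M B - measure N B\<bar> \<le> total_variation M N"
    unfolding total_variation_def by (rule cSUP_upper[OF B bdd])
  then show "measure M B \<le> measure N B + total_variation M N" "0 \<le> total_variation M N"
    using abs_ge_zero[of "measure M B - measure N B"] by linarith+
qed

section \<open>Information at stopping times\<close>

locale agent_run = agent_setting S
  for S :: "('t, 'o, 'c) setting" +
  fixes R :: "('w, 't, 'o, 'c) run" and K :: nat
  assumes run: "valid_run S R K"
begin

sublocale P: prob_space "Pr R" using run by (simp add: valid_run_def)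

sublocale filtration "space (Pr R)" "past R" using run by (simp add: valid_run_def)

lemma subalgebra_past: "subalgebra (Pr R) (past R n)"
  and task_measurable[measurable]: "task R n \<in> Pr R \<rightarrow>\<^sub>M T"
  and outp_measurable[measurable]: "outp R n \<in> Pr R \<rightarrow>\<^sub>M Out"
  and stopping_step_start: "k \<le> K \<Longrightarrow> stopping_time (past R) (step_start R k)"
  and agent_measurable_pre: "k \<le> K \<Longrightarrow> agent R k \<in> pre R (step_start R k) \<rightarrow>\<^sub>M Ag"
  using run by (simp_all add: valid_run_def)

text \<open>Stopping times are natural numbers here, so an event is the countable union of its
  traces on \<open>\<tau> \<omega> \<le> n\<close>, each of which is known at time
  \<open>n\<close>.\<close>

lemma subalgebra_pre:
  assumes \<tau>: "stopping_time (past R) \<tau>"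
  shows "subalgebra (Pr R) (pre R \<tau>)"
  unfolding subalgebra_def
proof (intro conjI subsetI)
  show "space (pre R \<tau>) = space (Pr R)" by (rule space_pre_sigma)
  fix A assume "A \<in> sets (pre R \<tau>)"
  then have "{\<omega> \<in> A. \<tau> \<omega> \<le> n} \<in> sets (Pr R)" for n
    using sets_pre_sigmaD[OF \<tau>] subalgebra_past unfolding subalgebra_def by blast
  then have "(\<Union>n. {\<omega> \<in> A. \<tau> \<omega> \<le> n}) \<in> sets (Pr R)" by blast
  also have "(\<Union>n. {\<omega> \<in> A. \<tau> \<omega> \<le> n}) = A" by auto
  finally show "A \<in> sets (Pr R)" .
qed

lemma agent_measurable[measurable]: "k \<le> K \<Longrightarrow> agent R k \<in> Pr R \<rightarrow>\<^sub>M Ag"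
  using measurable_from_subalg[OF subalgebra_pre agent_measurable_pre] stopping_step_start by blast

end

locale agent_step = agent_run S R K
  for S :: "('t, 'o, 'c) setting" and R :: "('w, 't, 'o, 'c) run" and K +
  fixes k :: nat
  assumes k_less: "k < K"
    and step: "one_candidate_step S R k"
    and conditions: "standard_conditions S R k"
begin

abbreviation "nF \<equiv> n_F (params R k)"
abbreviation "nR \<equiv> n_R (params R k)"
abbreviation "nV \<equiv> n_roll (params R k)"
abbreviation "mixing \<equiv> 2 * real nR * beta S R (gap (params R k))"
abbreviation "win_info \<equiv> info S R (pre R (win_start R k)) (win_end R k)"

lemma params_pos: "0 < nF" "0 < nR" "0 < nV" "0 < risk_V (params R k)" "risk_V (params R k) < 1"
  "risk_Z (params R k) < 1" "risk_R (params R k) < 1" "0 < risk_Z (params R k)" "0 < risk_R (params R k)"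
  "0 < tau (params R k)" "0 < delta (params R k)"
  using step by (auto simp: one_candidate_step_def valid_params_def)

lemma window: "failure_window S R k" and sample: "stored_sample S R k" and eval: "evaluation S R k"
  and gen: "generation_phase S R k" and upd: "two_gate_update S R k"
  using step by (auto simp: one_candidate_step_def)

lemma stopping_win: "stopping_time (past R) (win_start R k)"
  and gen_out_pre: "gen_out R k \<in> pre R (win_start R k) \<rightarrow>\<^sub>M option_space (mod_space S)"
  and eps_F_pre: "eps_F R k \<in> borel_measurable (pre R (win_start R k))"
  and horizon_pre: "horizon R k \<in> pre R (win_start R k) \<rightarrow>\<^sub>M count_space UNIV"
  using window by (auto simp: failure_window_def)

lemma win_start_pre: "win_start R k \<in> pre R (win_start R k) \<rightarrow>\<^sub>M count_space UNIV"
  using measurable_stopping_time_pre_sigma[OF stopping_win]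
  by (simp add: measurable_cong_sets[OF refl sets_borel_eq_count_space])

lemma subalgebra_win_pre: "subalgebra (Pr R) (pre R (win_start R k))"
  by (rule subalgebra_pre[OF stopping_win])

text \<open>The agent is known at the start of the step, and the generation phase lies between that
  time and the window, so the information only grows.\<close>

lemma agent_pre: "agent R k \<in> pre R (win_start R k) \<rightarrow>\<^sub>M Ag"
proof -
  have "subalgebra (pre R (win_start R k)) (pre R (step_start R k))"
    unfolding subalgebra_def
  proof (intro conjI mono_pre_sigma)
    show "step_start R k \<omega> \<le> win_start R k \<omega>" if "\<omega> \<in> space (Pr R)" for \<omega>
      using gen that unfolding generation_phase_def by (meson order_trans)
  qed (use stopping_step_start k_less stopping_win in \<open>auto simp: space_pre_sigma\<close>)
  then show ?thesis using agent_measurable_pre k_less by (auto intro: measurable_from_subalg)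
qed

lemma rollouts_cond_law:
  assumes "J \<subseteq> {..<nR}"
  shows "cond_law_on (Pr R) win_info {\<omega> \<in> Cand R k \<inter> Ready S R k. S_R R k \<omega> = J}
    (\<lambda>\<omega>. \<lambda>s\<in>rollout_index R k J. rollout R k s \<omega>) (PiM (rollout_index R k J) (\<lambda>_. Out))
    (\<lambda>\<omega>. PiM (rollout_index R k J) (\<lambda>(e, b, l). eval_agent S R k b \<omega> (eval_task S R k e \<omega>)))"
  using eval assms unfolding evaluation_def by blast

lemma subalgebra_win_info: "subalgebra (Pr R) win_info"
  using rollouts_cond_law[of "{}"] unfolding cond_law_on_def by blast

lemma sets_win_info:
  "sets win_info = sigma_sets (space (Pr R))
       (sets (pre R (win_start R k)) \<union>
        {task R n -` B \<inter> space (Pr R) | n B. B \<in> sets T} \<union>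
        {{\<omega> \<in> space (Pr R). n < win_end R k \<omega> \<and> outp R n \<omega> \<in> B} | n B. B \<in> sets Out})"
  unfolding info_def
  by (rule sets_measure_of) (use sets.sets_into_space[of _ "pre R (win_start R k)"] in \<open>auto simp: space_pre_sigma\<close>)

lemma space_win_info: "space win_info = space (Pr R)"
  using subalgebra_win_info by (simp add: subalgebra_def)

lemma subalgebra_info_pre: "subalgebra win_info (pre R (win_start R k))"
  unfolding subalgebra_def sets_win_info space_win_info by (auto simp: space_pre_sigma)

lemma task_info[measurable]: "task R n \<in> win_info \<rightarrow>\<^sub>M T"
proof (rule measurableI)
  show "task R n \<omega> \<in> space T" if "\<omega> \<in> space win_info" for \<omega>
    using that measurable_space[OF task_measurable] by (simp add: space_win_info)
  show "task R n -` B \<inter> space win_info \<in> sets win_info" if "B \<in> sets T" for B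
    unfolding space_win_info unfolding sets_win_info using that by blast
qed

lemma win_end_info: "win_end R k \<in> win_info \<rightarrow>\<^sub>M count_space UNIV"
  and win_start_info: "win_start R k \<in> win_info \<rightarrow>\<^sub>M count_space UNIV"
proof -
  have m: "horizon R k \<in> win_info \<rightarrow>\<^sub>M count_space UNIV" "win_start R k \<in> win_info \<rightarrow>\<^sub>M count_space UNIV"
    using measurable_from_subalg[OF subalgebra_info_pre] horizon_pre win_start_pre by auto
  then show "win_start R k \<in> win_info \<rightarrow>\<^sub>M count_space UNIV" by simp
  show "win_end R k \<in> win_info \<rightarrow>\<^sub>M count_space UNIV"
    using m unfolding win_end_def[abs_def] by measurable
qed

text \<open>The information at the end of the window reveals output \<open>n\<close> only on the
  event that arrival \<open>n\<close> precedes this random end. The mark is therefore read on that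
  event and the event is kept in the statement.\<close>

lemma mark_info: "Measurable.pred win_info (\<lambda>\<omega>. n < win_end R k \<omega> \<and> mark S R n \<omega>)"
proof -
  let ?E = "{\<omega> \<in> space win_info. n < win_end R k \<omega>}"
  have E: "?E \<inter> space win_info \<in> sets win_info" using win_end_info by measurable
  let ?F = "restrict_space win_info ?E"
  have "outp R n \<in> ?F \<rightarrow>\<^sub>M Out"
  proof (rule measurableI)
    show "outp R n \<omega> \<in> space Out" if "\<omega> \<in> space ?F" for \<omega>
      using that measurable_space[OF outp_measurable] by (simp add: space_restrict_space space_win_info)
    fix B assume "B \<in> sets Out"
    then have "{\<omega> \<in> space (Pr R). n < win_end R k \<omega> \<and> outp R n \<omega> \<in> B} \<in> sets win_info"
      unfolding sets_win_info by blast
    moreover have "outp R n -` B \<inter> space ?F = {\<omega> \<in> space (Pr R). n < win_end R k \<omega> \<and> outp R n \<omega> \<in> B}"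
      by (auto simp: space_restrict_space space_win_info)
    ultimately show "outp R n -` B \<inter> space ?F \<in> sets ?F"
      unfolding sets_restrict_space_iff[OF E] by (auto simp: space_win_info)
  qed
  from measurable_compose[OF measurable_Pair[OF measurable_restrict_space1[OF task_info] this] detector_measurable]
  have "Measurable.pred ?F (mark S R n)" by (simp add: mark_def[abs_def])
  then have "{\<omega> \<in> space ?F. mark S R n \<omega>} \<in> sets ?F" by (simp add: pred_def)
  then have "{\<omega> \<in> space ?F. mark S R n \<omega>} \<in> sets win_info" unfolding sets_restrict_space_iff[OF E] by simp
  also have "{\<omega> \<in> space ?F. mark S R n \<omega>} = {\<omega> \<in> space win_info. n < win_end R k \<omega> \<and> mark S R n \<omega>}"
    by (auto simp: space_restrict_space)
  finally show ?thesis by (simp add: pred_def)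
qed

text \<open>Both ends of the window are random but take countably many values, so fixed ends can be
  treated first and the random ones substituted afterwards.\<close>

lemma win_fails_info: "win_fails S R k \<in> win_info \<rightarrow>\<^sub>M count_space UNIV"
proof -
  have "(\<lambda>\<omega>. filter (\<lambda>n. n < win_end R k \<omega> \<and> mark S R n \<omega>) [a..<b]) \<in> win_info \<rightarrow>\<^sub>M count_space UNIV" for a b
    by (rule filter_measurable[OF mark_info])
  then have "(\<lambda>\<omega>. filter (\<lambda>n. n < win_end R k \<omega> \<and> mark S R n \<omega>) [win_start R k \<omega>..<b])
      \<in> win_info \<rightarrow>\<^sub>M count_space UNIV" for b
    by (rule measurable_compose_countable[OF _ win_start_info])
  from measurable_compose_countable[OF this win_end_info]
  have "(\<lambda>\<omega>. filter (\<lambda>n. n < win_end R k \<omega> \<and> mark S R n \<omega>) [win_start R k \<omega>..<win_end R k \<omega>])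
      \<in> win_info \<rightarrow>\<^sub>M count_space UNIV" .
  \<comment> \<open>The guard \<open>n < win_end R k \<omega>\<close> holds for every index of this
    list, so it changes nothing here; it was needed for the lists with fixed ends.\<close>
  moreover have "filter (\<lambda>n. n < win_end R k \<omega> \<and> mark S R n \<omega>) [win_start R k \<omega>..<win_end R k \<omega>]
      = win_fails S R k \<omega>" for \<omega>
    unfolding win_fails_def fails_def by (rule filter_cong) auto
  ultimately show ?thesis by simp
qed

text \<open>If the batch is too short, \<open>!\<close> yields an unspecified number, but still a
  function of a list in a discrete space. So no restriction to \<open>RetF\<close> is
  required.\<close>

lemma fail_task_info: "fail_task S R k i \<in> win_info \<rightarrow>\<^sub>M T"
proof -
  have "(\<lambda>\<omega>. win_fails S R k \<omega> ! i) \<in> win_info \<rightarrow>\<^sub>M count_space UNIV"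
    by (rule measurable_compose[OF win_fails_info]) simp
  from measurable_compose_countable[OF task_info this] show ?thesis by (simp add: fail_task_def[abs_def])
qed

text \<open>Off \<open>Cand\<close> the agent \<open>cand\<close> is a junk value; replacing it by the current agent gives
  measurability on the whole space.\<close>

definition cand_total :: "'w \<Rightarrow> ('t, 'o) agent" where
  "cand_total \<omega> = (if gen_out R k \<omega> = None then agent R k \<omega> else cand S R k \<omega>)"

lemma cand_total_eq: "\<omega> \<in> Cand R k \<Longrightarrow> cand_total \<omega> = cand S R k \<omega>"
  by (auto simp: cand_total_def Cand_def)

lemma cand_total_measurable:
  "agent R k \<in> M \<rightarrow>\<^sub>M Ag \<Longrightarrow> gen_out R k \<in> M \<rightarrow>\<^sub>M option_space (mod_space S) \<Longrightarrow> cand_total \<in> M \<rightarrow>\<^sub>M Ag"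
  unfolding cand_total_def[abs_def] cand_def by (rule oplus_option_measurable)

lemma cand_total_pre: "cand_total \<in> pre R (win_start R k) \<rightarrow>\<^sub>M Ag"
  by (rule cand_total_measurable[OF agent_pre gen_out_pre])

lemma agent_k[measurable]: "agent R k \<in> Pr R \<rightarrow>\<^sub>M Ag"
  and cand_total_P[measurable]: "cand_total \<in> Pr R \<rightarrow>\<^sub>M Ag"
  and eps_F_P[measurable]: "eps_F R k \<in> borel_measurable (Pr R)"
  and gen_out_P: "gen_out R k \<in> Pr R \<rightarrow>\<^sub>M option_space (mod_space S)"
  using measurable_from_subalg[OF subalgebra_win_pre] agent_pre cand_total_pre eps_F_pre gen_out_pre by auto

lemma fail_task_P[measurable]: "fail_task S R k i \<in> Pr R \<rightarrow>\<^sub>M T"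
  and win_fails_P: "win_fails S R k \<in> Pr R \<rightarrow>\<^sub>M count_space UNIV"
  using measurable_from_subalg[OF subalgebra_win_info] fail_task_info win_fails_info by auto

lemma rec_task_P[measurable]: "j < nR \<Longrightarrow> rec_task R k j \<in> Pr R \<rightarrow>\<^sub>M T"
  and rec_label_P[measurable]: "j < nR \<Longrightarrow> rec_label R k j \<in> Pr R \<rightarrow>\<^sub>M count_space UNIV"
  using sample by (auto simp: stored_sample_def)

lemma agent_in: "\<omega> \<in> space (Pr R) \<Longrightarrow> agent R k \<omega> \<in> space Ag"
  and cand_total_in: "\<omega> \<in> space (Pr R) \<Longrightarrow> cand_total \<omega> \<in> space Ag"
  and fail_task_in: "\<omega> \<in> space (Pr R) \<Longrightarrow> fail_task S R k i \<omega> \<in> space T"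
  using measurable_space[OF agent_k] measurable_space[OF cand_total_P] measurable_space[OF fail_task_P] by auto

lemma avail_sets: "avail R k \<in> sets (Pr R)"
  using sample subalgebra_win_pre by (auto simp: stored_sample_def subalgebra_def)

lemma Cand_sets[measurable]: "Cand R k \<in> sets (Pr R)"
proof -
  have "gen_out R k -` {None} \<inter> space (Pr R) \<in> sets (Pr R)"
    by (rule measurable_sets[OF gen_out_P None_in_sets_option_space])
  moreover have "Cand R k = space (Pr R) - (gen_out R k -` {None} \<inter> space (Pr R))"
    by (auto simp: Cand_def)
  ultimately show ?thesis by auto
qed

lemma RetF_sets[measurable]: "RetF S R k \<in> sets (Pr R)"
  using measurable_compose[OF win_fails_P, of "\<lambda>xs. nF \<le> length xs" "count_space UNIV"]
  by (auto simp: RetF_def pred_def)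

lemma card_S_R: "real (card (S_R R k \<omega>)) = (\<Sum>j<nR. of_bool (\<not> rec_label R k j \<omega>))"
proof -
  have "S_R R k \<omega> = {..<nR} \<inter> {j. \<not> rec_label R k j \<omega>}" by (auto simp: S_R_def)
  then show ?thesis by (simp add: sum_of_bool_eq)
qed

text \<open>A sum over a random set turns into a sum of fixed length with random weights, which is
  visibly measurable and has one summand for each record.\<close>

lemma sum_S_R: "(\<Sum>j\<in>S_R R k \<omega>. f j) = (\<Sum>j<nR. of_bool (\<not> rec_label R k j \<omega>) * f j)"
  for f :: "nat \<Rightarrow> real"
proof -
  have "S_R R k \<omega> = {j \<in> {..<nR}. \<not> rec_label R k j \<omega>}" by (auto simp: S_R_def)
  then have "(\<Sum>j\<in>S_R R k \<omega>. f j) = (\<Sum>j<nR. if \<not> rec_label R k j \<omega> then f j else 0)"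
    by (simp only: sum.inter_filter[OF finite_lessThan])
  also have "\<dots> = (\<Sum>j<nR. of_bool (\<not> rec_label R k j \<omega>) * f j)" by (intro sum.cong) auto
  finally show ?thesis .
qed

lemma card_S_R_measurable[measurable]: "(\<lambda>\<omega>. real (card (S_R R k \<omega>))) \<in> borel_measurable (Pr R)"
  unfolding card_S_R by measurable

lemma Ready_sets[measurable]: "Ready S R k \<in> sets (Pr R)"
proof -
  have "ReadyR R k = avail R k \<inter> {\<omega> \<in> space (Pr R). 1 \<le> real (card (S_R R k \<omega>))}"
    by (auto simp: ReadyR_def)
  also have "\<dots> \<in> sets (Pr R)" using avail_sets by measurable
  finally show ?thesis unfolding Ready_def by auto
qed

lemma rollout_P:
  assumes "s \<in> rollout_index R k {..<nR}"
  shows "rollout R k s \<in> Pr R \<rightarrow>\<^sub>M Out"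
proof (rule measurable_from_subalg[OF subalgebra_pre[OF stopping_step_start]])
  show "Suc k \<le> K" using k_less by simp
  show "rollout R k s \<in> pre R (step_start R (Suc k)) \<rightarrow>\<^sub>M Out"
    using eval assms unfolding evaluation_def by blast
qed

lemma V_hat_measurable[measurable]:
  assumes "e \<in> {..<nF} <+> {..<nR}"
  shows "V_hat S R k b e \<in> borel_measurable (Pr R)"
proof -
  have [measurable]: "rollout R k (e, b, l) \<in> Pr R \<rightarrow>\<^sub>M Out" if "l < nV" for l
    using that assms by (intro rollout_P) (auto simp: rollout_index_def)
  have [measurable]: "eval_task S R k e \<in> Pr R \<rightarrow>\<^sub>M T"
    using assms unfolding eval_task_def[abs_def] by (auto split: sum.split)
  show ?thesis unfolding V_hat_def[abs_def] by measurable
qed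

lemma estimates_measurable[measurable]:
  "Z_hat R k \<in> borel_measurable (Pr R)" "L_hat S R k \<in> borel_measurable (Pr R)"
  "D_hat S R k \<in> borel_measurable (Pr R)"
proof -
  have [measurable]: "V_hat S R k b (Inl i) \<in> borel_measurable (Pr R)" if "i < nF" for i b
    using that by (intro V_hat_measurable) auto
  have [measurable]: "V_hat S R k b (Inr i) \<in> borel_measurable (Pr R)" if "i < nR" for i b
    using that by (intro V_hat_measurable) auto
  show "Z_hat R k \<in> borel_measurable (Pr R)" unfolding Z_hat_def[abs_def] by measurable
  then show "L_hat S R k \<in> borel_measurable (Pr R)" unfolding L_hat_def[abs_def] by measurable
  show "D_hat S R k \<in> borel_measurable (Pr R)" unfolding D_hat_def[abs_def] sum_S_R by measurable
qed

lemma Delta_measurable[measurable]: "Delta S R k \<in> borel_measurable (Pr R)"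
  unfolding Delta_def[abs_def] eps_L_def eps_D_def by measurable

lemma adopts_measurable[measurable]: "Measurable.pred (Pr R) (adopts S R k)"
  unfolding adopts_def[abs_def] by measurable

end

section \<open>Exceptional events of a step\<close>

lemma (in agent_step) reference_sample_bound:
  fixes g :: "'w \<Rightarrow> 't \<times> bool \<Rightarrow> real"
  defines "G \<equiv> frozen R k" and "N \<equiv> records_space S R k"
  assumes g: "(\<lambda>(\<omega>, x). g \<omega> x) \<in> borel_measurable (G \<Otimes>\<^sub>M record_space S)"
    and g01: "\<And>\<omega> t b. \<omega> \<in> space (Pr R) \<Longrightarrow> t \<in> space T \<Longrightarrow> g \<omega> (t, b) \<in> {0..1}"
    and \<mu>[measurable]: "\<mu> \<in> borel_measurable G"
    and mean: "\<And>\<omega>. \<omega> \<in> space (Pr R) \<Longrightarrow> (\<integral>x. g \<omega> x \<partial>record_law S (agent R k \<omega>)) = \<mu> \<omega>"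
    and r: "mixing < r" "r < 1"
  shows "measure (Pr R) {\<omega> \<in> space (Pr R).
      \<bar>1 / real nR * (\<Sum>j<nR. g \<omega> (rec_task R k j \<omega>, rec_label R k j \<omega>)) - \<mu> \<omega>\<bar>
        > sqrt (ln (2 / (r - mixing)) / (2 * real nR))} \<le> r" (is "measure _ ?B \<le> r")
proof -
  have sub: "subalgebra (Pr R) G" and "record_cond S R k"
    using conditions by (auto simp: standard_conditions_def record_cond_def G_def)
  then obtain Q where Q: "prob_space Q" "sets Q = sets (G \<Otimes>\<^sub>M N)"
    and c: "cond_law_on Q (vimage_algebra (space Q) fst G) (space Q) snd N
          (\<lambda>(\<omega>, _). PiM {..<nR} (\<lambda>_. record_law S (agent R k \<omega>)))"
    and tv: "total_variation (distr (Pr R) (G \<Otimes>\<^sub>M N) (\<lambda>\<omega>. (\<omega>, records R k \<omega>))) Q \<le> mixing"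
    unfolding record_cond_def G_def N_def by blast
  interpret Q: prob_space Q by fact
  have spG: "space G = space (Pr R)" using sub by (simp add: subalgebra_def)
  have spQ: "space Q = space G \<times> space N" using sets_eq_imp_space_eq[OF Q(2)] by (simp add: space_pair_measure)
  have spRec: "space (record_space S) = space T \<times> UNIV" by (simp add: record_space_def space_pair_measure)
  have [measurable]: "(\<lambda>x. x) \<in> Pr R \<rightarrow>\<^sub>M G" using sub by (auto intro: measurable_from_subalg)
  have rec[measurable]: "records R k \<in> Pr R \<rightarrow>\<^sub>M N"
    unfolding records_def[abs_def] N_def record_space_def by measurable
  have pair[measurable]: "(\<lambda>\<omega>. (\<omega>, records R k \<omega>)) \<in> Pr R \<rightarrow>\<^sub>M G \<Otimes>\<^sub>M N" by measurable
  let ?law = "distr (Pr R) (G \<Otimes>\<^sub>M N) (\<lambda>\<omega>. (\<omega>, records R k \<omega>))"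
  have pl: "prob_space ?law" by (rule P.prob_space_distr[OF pair])
  \<comment> \<open>The sign of the mixing coefficient is not visible from its definition by real
    suprema and infima; it follows because it dominates a total variation.\<close>
  have mix0: "0 \<le> mixing" using total_variation_bound(2)[OF pl Q(1), of "{}"] tv by simp
  define \<beta> where "\<beta> = r - mixing"
  have \<beta>: "0 < \<beta>" "\<beta> \<le> 2" using r mix0 by (auto simp: \<beta>_def)
  define dev where "dev = (\<lambda>\<omega> y. \<bar>1 / real nR * (\<Sum>j<nR. g \<omega> (y j)) - \<mu> \<omega>\<bar> > sqrt (ln (2 / \<beta>) / (2 * real nR)))"
  define W0 where "W0 = {q \<in> space (G \<Otimes>\<^sub>M N). dev (fst q) (snd q)}"
  \<comment> \<open>The first factor is left general, since the same sum is measured once over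
    \<open>G\<close> and once over the information generated by \<open>fst\<close> on
    \<open>Q\<close>.\<close>
  have gm: "(\<lambda>q. g (a q) (snd q j)) \<in> borel_measurable (M \<Otimes>\<^sub>M N)"
    if "a \<in> M \<Otimes>\<^sub>M N \<rightarrow>\<^sub>M G" "j < nR" for a j and M :: "'z measure"
  proof -
    have "(\<lambda>q. snd q j) \<in> M \<Otimes>\<^sub>M N \<rightarrow>\<^sub>M record_space S"
      using measurable_compose[OF measurable_snd measurable_component_singleton[of j "{..<nR}" "\<lambda>_. record_space S"]]
        that(2) unfolding N_def by simp
    then have "(\<lambda>q. (a q, snd q j)) \<in> M \<Otimes>\<^sub>M N \<rightarrow>\<^sub>M G \<Otimes>\<^sub>M record_space S"
      using that(1) by (simp only: measurable_Pair)
    then have "(\<lambda>q. (\<lambda>(\<omega>, x). g \<omega> x) (a q, snd q j)) \<in> borel_measurable (M \<Otimes>\<^sub>M N)"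
      using g by (rule measurable_compose)
    then show ?thesis by (simp only: prod.case)
  qed
  have W0: "W0 \<in> sets (G \<Otimes>\<^sub>M N)"
  proof -
    have "(\<lambda>q. \<Sum>j<nR. g (fst q) (snd q j)) \<in> borel_measurable (G \<Otimes>\<^sub>M N)"
      by (rule borel_measurable_sum, rule gm[of fst], rule measurable_fst) simp
    then show ?thesis unfolding W0_def dev_def by measurable
  qed
  let ?F = "restrict_space (vimage_algebra (space Q) fst G) (space Q)"
  define W where "W = {p \<in> space (?F \<Otimes>\<^sub>M N). dev (fst (fst p)) (snd p)}"
  have fst_F: "fst \<in> ?F \<rightarrow>\<^sub>M G"
    using spQ by (intro measurable_restrict_space1 measurable_vimage_algebra1) auto
  have Wm: "W \<in> sets (?F \<Otimes>\<^sub>M N)"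
  proof -
    have F1: "(\<lambda>p. fst (fst p)) \<in> ?F \<Otimes>\<^sub>M N \<rightarrow>\<^sub>M G"
      by (rule measurable_compose[OF measurable_fst fst_F])
    have "(\<lambda>p. \<Sum>j<nR. g (fst (fst p)) (snd p j)) \<in> borel_measurable (?F \<Otimes>\<^sub>M N)"
      by (rule borel_measurable_sum, rule gm[OF F1]) simp
    moreover have "(\<lambda>p. \<mu> (fst (fst p))) \<in> borel_measurable (?F \<Otimes>\<^sub>M N)"
      by (rule measurable_compose[OF F1 \<mu>])
    ultimately show ?thesis unfolding W_def dev_def by measurable
  qed
  have spW: "space (?F \<Otimes>\<^sub>M N) = space Q \<times> space N"
    by (simp add: space_pair_measure space_restrict_space)
  have "measure Q {q \<in> space Q. (q, snd q) \<in> W} \<le> \<beta> * measure Q (space Q)"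
  proof (rule cond_law_on_measure_le[OF Q(1) c Wm])
    fix q assume q: "q \<in> space Q"
    obtain \<omega> y where qy: "q = (\<omega>, y)" by (cases q)
    then have w: "\<omega> \<in> space (Pr R)" using q spQ spG by auto
    let ?L = "record_law S (agent R k \<omega>)"
    note L = record_law_props[OF agent_in[OF w]]
    have "space (PiM {..<nR} (\<lambda>_. ?L)) = space N"
      unfolding N_def using L spRec by (simp add: space_PiM)
    then have "Pair q -` W = {y \<in> space (PiM {..<nR} (\<lambda>_. ?L)). dev \<omega> y}"
      using q unfolding W_def spW qy by auto
    also have "measure (PiM {..<nR} (\<lambda>_. ?L)) \<dots> \<le> \<beta>"
    proof -
      have "g \<omega> \<in> borel_measurable (record_space S)"
        using measurable_Pair2[OF g, of \<omega>] w spG by simp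
      then have "g \<omega> \<in> borel_measurable ?L" by (simp add: measurable_cong_sets[OF L(2)])
      then show ?thesis
        unfolding dev_def using hoeffding_PiM[of "{..<nR}" "{..<nR}" "\<lambda>_. ?L" "\<lambda>_. g \<omega>" "\<mu> \<omega>" \<beta>]
          params_pos L g01[OF w] mean[OF w] \<beta> by auto
    qed
    finally show "measure ((\<lambda>(\<omega>, _). PiM {..<nR} (\<lambda>_. record_law S (agent R k \<omega>))) q) (Pair q -` W) \<le> \<beta>"
      by (simp add: qy)
  qed (use \<beta> in simp)
  moreover have "{q \<in> space Q. (q, snd q) \<in> W} = W0"
  proof -
    have GN: "space (G \<Otimes>\<^sub>M N) = space Q" using spQ by (simp only: space_pair_measure)
    have sn: "q \<in> space Q \<Longrightarrow> snd q \<in> space N" for q using spQ by (simp only: mem_Times_iff)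
    show ?thesis
      unfolding W_def W0_def spW GN by (rule Collect_cong) (simp only: mem_Collect_eq mem_Times_iff fst_conv snd_conv sn simp_thms cong: conj_cong)
  qed
  ultimately have Q_le: "measure Q W0 \<le> \<beta>" by (simp add: Q.prob_space)
  have "?B = (\<lambda>\<omega>. (\<omega>, records R k \<omega>)) -` W0 \<inter> space (Pr R)"
  proof -
    have "(\<Sum>j<nR. g \<omega> (records R k \<omega> j)) = (\<Sum>j<nR. g \<omega> (rec_task R k j \<omega>, rec_label R k j \<omega>))" for \<omega>
      by (intro sum.cong) (auto simp: records_def)
    then show ?thesis
      using measurable_space[OF pair] unfolding W0_def dev_def \<beta>_def by auto
  qed
  then have "measure (Pr R) ?B = measure ?law W0" by (simp add: measure_distr[OF pair W0])
  also have "\<dots> \<le> measure Q W0 + total_variation ?law Q"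
    using total_variation_bound(1)[OF pl Q(1)] W0 by simp
  also have "\<dots> \<le> \<beta> + mixing" using Q_le tv by simp
  finally show ?thesis by (simp add: \<beta>_def)
qed

context agent_step
begin

text \<open>The loss is left unnormalised, without division by \<open>1 - Z\<close>, in agreement
  with the second term of \<open>J_diff\<close>.\<close>

definition retained_mass :: "'w \<Rightarrow> real" where
  "retained_mass \<omega> = (\<integral>t. (1 - psi S (agent R k \<omega>) t) * \<bar>Adv S (agent R k \<omega>) (cand_total \<omega>) t\<bar> \<partial>D)"

definition sample_loss :: "'w \<Rightarrow> real" where
  "sample_loss \<omega> = 1 / real nR * (\<Sum>j<nR. of_bool (\<not> rec_label R k j \<omega>) *
     \<bar>Adv S (agent R k \<omega>) (cand_total \<omega>) (rec_task R k j \<omega>)\<bar>)"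

lemma frozen_measurable:
  "agent R k \<in> frozen R k \<rightarrow>\<^sub>M Ag" "cand_total \<in> frozen R k \<rightarrow>\<^sub>M Ag"
  "mixing < risk_Z (params R k)" "mixing < risk_R (params R k)"
  using conditions cand_total_measurable by (auto simp: standard_conditions_def record_cond_def)

lemma Z_hat_bound:
  "measure (Pr R) {\<omega> \<in> space (Pr R). \<bar>Z_hat R k \<omega> - Z S (agent R k \<omega>)\<bar> > eps_Z S R k} \<le> risk_Z (params R k)"
proof -
  note [measurable] = frozen_measurable(1)
  have "(\<lambda>(\<omega>, x). of_bool (snd x) :: real) \<in> borel_measurable (frozen R k \<Otimes>\<^sub>M record_space S)"
    unfolding record_space_def by measurable
  moreover have "(\<integral>x. of_bool (snd x) \<partial>record_law S (agent R k \<omega>)) = Z S (agent R k \<omega>)"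
    if "\<omega> \<in> space (Pr R)" for \<omega>
    unfolding Z_def by (subst integral_record_law[OF agent_in[OF that]]) (auto simp: record_space_def)
  ultimately show ?thesis
    using reference_sample_bound[of "\<lambda>\<omega> x. of_bool (snd x)" "\<lambda>\<omega>. Z S (agent R k \<omega>)" "risk_Z (params R k)"]
      frozen_measurable params_pos
    by (simp add: Z_hat_def eps_Z_def risk_Z_adj_def)
qed

lemma sample_loss_bound:
  "measure (Pr R) {\<omega> \<in> space (Pr R). \<bar>sample_loss \<omega> - retained_mass \<omega>\<bar> > eps_R S R k} \<le> risk_R (params R k)"
proof -
  note [measurable] = frozen_measurable(1,2)
  let ?f = "\<lambda>\<omega> t. \<bar>Adv S (agent R k \<omega>) (cand_total \<omega>) t\<bar>"
  let ?g = "\<lambda>\<omega> x. of_bool (\<not> snd x) * ?f \<omega> (fst x)"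
  have g: "(\<lambda>(\<omega>, x). ?g \<omega> x) \<in> borel_measurable (frozen R k \<Otimes>\<^sub>M record_space S)"
    unfolding record_space_def by measurable
  have f1: "?f \<omega> t \<le> 1" if "\<omega> \<in> space (Pr R)" "t \<in> space T" for \<omega> t
    using abs_Adv_le_1 agent_in cand_total_in that by blast
  have \<mu>: "retained_mass \<in> borel_measurable (frozen R k)"
    unfolding retained_mass_def[abs_def] by (rule U.borel_measurable_lebesgue_integral) measurable
  have "(\<integral>x. ?g \<omega> x \<partial>record_law S (agent R k \<omega>)) = retained_mass \<omega>" if w: "\<omega> \<in> space (Pr R)" for \<omega>
  proof -
    have m: "Adv S (agent R k \<omega>) (cand_total \<omega>) \<in> borel_measurable T"
      using Adv_measurable1 agent_in cand_total_in w by blast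
    have "?g \<omega> \<in> borel_measurable (record_space S)"
      unfolding record_space_def using m by measurable
    then show ?thesis
      unfolding retained_mass_def using f1[OF w]
      by (subst integral_record_law[OF agent_in[OF w]]) auto
  qed
  then show ?thesis
    using reference_sample_bound[OF g _ \<mu> _ frozen_measurable(4)] f1 params_pos
    by (auto simp: sample_loss_def eps_R_def risk_R_adj_def)
qed

text \<open>The assumed bound concerns an event written with \<open>cand\<close>, whose
  measurability is not evident. On \<open>Cand\<close> it agrees with \<open>cand_total\<close>, and
  this exhibits the event as measurable, so the bound can enter a union bound.\<close>

lemma batch_bound:
  obtains B where "B \<in> sets (Pr R)" "measure (Pr R) B \<le> risk_F (params R k)"
    and "\<And>\<omega>. \<omega> \<in> Cand R k \<inter> RetF S R k - B \<Longrightarrow>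
      \<bar>1 / real nF * (\<Sum>i<nF. Adv S (agent R k \<omega>) (cand_total \<omega>) (fail_task S R k i \<omega>))
        - (\<integral>t. Adv S (agent R k \<omega>) (cand_total \<omega>) t \<partial>D_F S (agent R k \<omega>))\<bar> \<le> eps_F R k \<omega>"
proof
  let ?dev = "\<lambda>c \<omega>. \<bar>1 / real nF * (\<Sum>i<nF. Adv S (agent R k \<omega>) (c \<omega>) (fail_task S R k i \<omega>))
        - (\<integral>t. Adv S (agent R k \<omega>) (c \<omega>) t \<partial>D_F S (agent R k \<omega>))\<bar>"
  let ?B = "{\<omega> \<in> Cand R k \<inter> RetF S R k. ?dev cand_total \<omega> > eps_F R k \<omega>}"
  have [measurable]: "(\<lambda>\<omega>. \<integral>t. Adv S (agent R k \<omega>) (cand_total \<omega>) t \<partial>D_F S (agent R k \<omega>)) \<in> borel_measurable (Pr R)"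
    using measurable_compose[OF measurable_Pair[OF agent_k cand_total_P] D_F_Adv_integral_measurable] by simp
  have "{\<omega> \<in> space (Pr R). \<omega> \<in> Cand R k \<inter> RetF S R k \<and> ?dev cand_total \<omega> > eps_F R k \<omega>} \<in> sets (Pr R)"
    by measurable
  also have "{\<omega> \<in> space (Pr R). \<omega> \<in> Cand R k \<inter> RetF S R k \<and> ?dev cand_total \<omega> > eps_F R k \<omega>} = ?B"
    using sets.sets_into_space[OF Cand_sets] by auto
  finally show "?B \<in> sets (Pr R)" .
  have "?B = {\<omega> \<in> Cand R k \<inter> RetF S R k. ?dev (cand S R k) \<omega> > eps_F R k \<omega>}"
    using cand_total_eq by auto
  then show "measure (Pr R) ?B \<le> risk_F (params R k)"
    using conditions by (simp add: standard_conditions_def batch_cond_def)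
qed (auto simp: not_less)

text \<open>Record variables are placeholders off \<open>avail\<close> and \<open>cand\<close> is
  arbitrary off \<open>Cand\<close>. Measurability with respect to the window information is
  therefore claimed only on the event where evaluations take place.\<close>

lemma eval_measurable:
  assumes J: "J \<subseteq> {..<nR}" and e: "e \<in> {..<nF} <+> J"
  defines "E \<equiv> {\<omega> \<in> Cand R k \<inter> Ready S R k. S_R R k \<omega> = J}"
  shows "eval_task S R k e \<in> restrict_space win_info E \<rightarrow>\<^sub>M T"
    and "eval_agent S R k b \<in> restrict_space win_info E \<rightarrow>\<^sub>M Ag"
proof -
  have pre_E: "f \<in> restrict_space win_info E \<rightarrow>\<^sub>M M"
    if "f \<in> restrict_space (pre R (win_start R k)) A \<rightarrow>\<^sub>M M" "E \<subseteq> A" for f :: "'w \<Rightarrow> 'z" and M A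
  proof -
    have "subalgebra (restrict_space win_info E) (restrict_space (pre R (win_start R k)) E)"
      using subalgebra_info_pre by (auto simp: subalgebra_def space_restrict_space sets_restrict_space)
    then show ?thesis using measurable_restrict_mono[OF that] by (rule measurable_from_subalg)
  qed
  show "eval_task S R k e \<in> restrict_space win_info E \<rightarrow>\<^sub>M T"
  proof (cases e)
    case (Inl i)
    then show ?thesis
      using measurable_restrict_space1[OF fail_task_info] by (simp add: eval_task_def[abs_def])
  next
    case (Inr j)
    then have "rec_task R k j \<in> restrict_space (pre R (win_start R k)) (avail R k) \<rightarrow>\<^sub>M T"
      using sample e J by (auto simp: stored_sample_def)
    moreover have "E \<subseteq> avail R k" by (auto simp: E_def Ready_def ReadyR_def)
    ultimately show ?thesis using Inr by (auto simp: eval_task_def[abs_def] intro: pre_E)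
  qed
  have "(\<lambda>\<omega>. if b then cand_total \<omega> else agent R k \<omega>) \<in> restrict_space win_info E \<rightarrow>\<^sub>M Ag"
    using pre_E[OF measurable_restrict_space1 subset_UNIV] pre_E[OF measurable_restrict_space1 order_refl]
      agent_pre cand_total_pre by (cases b) auto
  moreover have "(if b then cand_total \<omega> else agent R k \<omega>) = eval_agent S R k b \<omega>"
    if "\<omega> \<in> space (restrict_space win_info E)" for \<omega>
    using that cand_total_eq by (auto simp: space_restrict_space E_def eval_agent_def)
  ultimately show "eval_agent S R k b \<in> restrict_space win_info E \<rightarrow>\<^sub>M Ag"
    by (simp cong: measurable_cong)
qed

section \<open>Rollout errors\<close>

text \<open>Given the window information, the tasks, the agents and the set \<open>J\<close> are
  fixed and the rollouts have a product law. The block of coordinates belonging to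
  \<open>(e, b)\<close> consists of draws from one measure, with mean reward \<open>V\<close>, so
  Hoeffding's inequality holds for every \<omega> in \<open>E\<close> and is then integrated over
  \<open>E\<close>.\<close>

lemma rollout_deviation:
  fixes b :: bool
  assumes J: "J \<subseteq> {..<nR}" and e: "e \<in> {..<nF} <+> J"
  defines "E \<equiv> {\<omega> \<in> Cand R k \<inter> Ready S R k. S_R R k \<omega> = J}"
  defines "B \<equiv> {\<omega> \<in> E. \<bar>V_hat S R k b e \<omega> - V S (eval_agent S R k b \<omega>) (eval_task S R k e \<omega>)\<bar> > eps_V R k}"
  shows "B \<in> sets (Pr R)" "measure (Pr R) B \<le> risk_V (params R k) * measure (Pr R) E"
proof -
  note law = rollouts_cond_law[OF J, folded E_def]
  have EF: "E \<in> sets win_info" and EP: "E \<in> sets (Pr R)"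
    using law subalgebra_win_info by (auto simp: cond_law_on_def subalgebra_def)
  have E_sub: "E \<subseteq> space (Pr R)" using sets.sets_into_space[OF EP] .
  have eR: "e \<in> {..<nF} <+> {..<nR}" using e J by auto
  have agent_eq: "eval_agent S R k b \<omega> = (if b then cand_total \<omega> else agent R k \<omega>)" if "\<omega> \<in> E" for \<omega>
    using that cand_total_eq by (auto simp: E_def eval_agent_def)
  have task_P[measurable]: "eval_task S R k e \<in> Pr R \<rightarrow>\<^sub>M T"
    using eR unfolding eval_task_def[abs_def] by (auto split: sum.split)
  have [measurable]: "V_hat S R k b e \<in> borel_measurable (Pr R)" using eR by (rule V_hat_measurable)
  have "{\<omega> \<in> space (Pr R). \<omega> \<in> E \<and> \<bar>V_hat S R k b e \<omega> - V S (if b then cand_total \<omega> else agent R k \<omega>)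
      (eval_task S R k e \<omega>)\<bar> > eps_V R k} \<in> sets (Pr R)"
    using EP by measurable
  also have "{\<omega> \<in> space (Pr R). \<omega> \<in> E \<and> \<bar>V_hat S R k b e \<omega> - V S (if b then cand_total \<omega> else agent R k \<omega>)
      (eval_task S R k e \<omega>)\<bar> > eps_V R k} = B"
    unfolding B_def using agent_eq E_sub by auto
  finally show "B \<in> sets (Pr R)" .

  let ?I = "rollout_index R k J" and ?F = "restrict_space win_info E"
  let ?N = "PiM ?I (\<lambda>_. Out)" and ?X = "\<lambda>\<omega>. \<lambda>s\<in>?I. rollout R k s \<omega>"
  let ?M = "\<lambda>\<omega> (e, b, l). eval_agent S R k b \<omega> (eval_task S R k e \<omega>)"
  let ?dev = "\<lambda>\<omega> x. \<bar>1 / real nV * (\<Sum>l<nV. reward S (eval_task S R k e \<omega>) (x (e, b, l)))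
      - V S (eval_agent S R k b \<omega>) (eval_task S R k e \<omega>)\<bar> > eps_V R k"
  define W where "W = {p \<in> space (?F \<Otimes>\<^sub>M ?N). ?dev (fst p) (snd p)}"
  have idx: "(e, b, l) \<in> ?I" if "l < nV" for l
    using e that by (auto simp: rollout_index_def)
  have finI: "finite ?I"
    using finite_subset[OF J] by (auto simp: rollout_index_def)
  have spF: "space ?F = E" using sets.sets_into_space[OF EF] by (auto simp: space_restrict_space)
  note [measurable] = eval_measurable[OF J e, folded E_def]
  have Wm: "W \<in> sets (?F \<Otimes>\<^sub>M ?N)"
  proof -
    have [measurable]: "(\<lambda>p. snd p (e, b, l)) \<in> ?F \<Otimes>\<^sub>M ?N \<rightarrow>\<^sub>M Out" if "l < nV" for l
      by (rule measurable_compose[OF measurable_snd measurable_component_singleton[OF idx[OF that]]])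
    show ?thesis unfolding W_def by measurable
  qed
  have "measure (Pr R) {\<omega> \<in> E. (\<omega>, ?X \<omega>) \<in> W} \<le> risk_V (params R k) * measure (Pr R) E"
  proof (rule cond_law_on_measure_le[OF P.prob_space_axioms law Wm])
    fix \<omega> assume w: "\<omega> \<in> E"
    then have wP: "\<omega> \<in> space (Pr R)" using E_sub by auto
    define t where "t = eval_task S R k e \<omega>"
    define A where "A = eval_agent S R k b \<omega>"
    have t: "t \<in> space T" unfolding t_def using measurable_space[OF task_P wP] .
    have A: "A \<in> space Ag" unfolding A_def agent_eq[OF w] using agent_in cand_total_in wP by auto
    have tasks: "eval_task S R k e' \<omega> \<in> space T" if "e' \<in> {..<nF} <+> J" for e'
      using measurable_space[OF eval_measurable(1)[OF J that, folded E_def], of \<omega>] w spF by simp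
    have agents: "eval_agent S R k b' \<omega> \<in> space Ag" for b'
      using measurable_space[OF eval_measurable(2)[OF J e, folded E_def], of \<omega> b'] w spF by simp
    have M: "prob_space (?M \<omega> i)" "sets (?M \<omega> i) = sets Out" "space (?M \<omega> i) = space Out" if "i \<in> ?I" for i
    proof -
      obtain e' b' l where e': "i = (e', b', l)" by (cases i)
      then have i: "i = (e', b', l)" "e' \<in> {..<nF} <+> J"
        using that by (simp_all add: rollout_index_def)
      then show "prob_space (?M \<omega> i)" "sets (?M \<omega> i) = sets Out" "space (?M \<omega> i) = space Out"
        using agent_prob[OF agents tasks[OF i(2)]] by simp_all
    qed
    have "space (PiM ?I (?M \<omega>)) = space ?N"
      using M(3) by (auto simp: space_PiM intro!: PiE_cong)
    then have "Pair \<omega> -` W = {x \<in> space (PiM ?I (?M \<omega>)). ?dev \<omega> x}"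
      using w spF unfolding W_def by (auto simp: space_pair_measure)
    \<comment> \<open>The average over \<open>l\<close> is rewritten as an average over a set of
      coordinates of the product, the form that \<open>hoeffding_PiM\<close> expects.\<close>
    also have "\<dots> = {x \<in> space (PiM ?I (?M \<omega>)).
        \<bar>1 / real (card ((\<lambda>l. (e, b, l)) ` {..<nV})) * (\<Sum>i\<in>(\<lambda>l. (e, b, l)) ` {..<nV}. reward S t (x i)) - V S A t\<bar>
          > sqrt (ln (2 / risk_V (params R k)) / (2 * real (card ((\<lambda>l. (e, b, l)) ` {..<nV}))))}"
    proof -
      have inj: "inj_on (\<lambda>l. (e, b, l)) {..<nV}" by (auto simp: inj_on_def)
      show ?thesis by (simp add: card_image[OF inj] sum.reindex[OF inj] eps_V_def t_def A_def)
    qed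
    also have "measure (PiM ?I (?M \<omega>)) \<dots> \<le> risk_V (params R k)"
    proof (rule hoeffding_PiM[where h = "\<lambda>_. reward S t"])
      fix i assume i: "i \<in> (\<lambda>l. (e, b, l)) ` {..<nV}"
      then have Mi: "?M \<omega> i = A t" by (auto simp: A_def t_def)
      have "reward S t \<in> borel_measurable Out"
        using measurable_Pair2[OF reward_measurable t] by simp
      then show "reward S t \<in> borel_measurable (?M \<omega> i)"
        unfolding Mi by (simp add: measurable_cong_sets[OF agent_prob(2)[OF A t]])
      show "(\<integral>x. reward S t x \<partial>?M \<omega> i) = V S A t" unfolding Mi V_def ..
      show "reward S t x \<in> {0..1}" if "x \<in> space (?M \<omega> i)" for x
        using that reward_01[OF t] agent_prob(3)[OF A t] unfolding Mi by simp
    qed (use finI idx M(1) params_pos in auto)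
    finally show "measure (PiM ?I (?M \<omega>)) (Pair \<omega> -` W) \<le> risk_V (params R k)" .
  qed (use params_pos in simp)
  also have "{\<omega> \<in> E. (\<omega>, ?X \<omega>) \<in> W} = B"
  proof -
    have "?X \<omega> \<in> space ?N" if "\<omega> \<in> E" for \<omega>
      using law measurable_space[of ?X "Pr R" ?N \<omega>] that E_sub unfolding cond_law_on_def by auto
    moreover have "(\<Sum>l<nV. reward S (eval_task S R k e \<omega>) (?X \<omega> (e, b, l)))
        = (\<Sum>l<nV. reward S (eval_task S R k e \<omega>) (rollout R k (e, b, l) \<omega>))" for \<omega>
      using idx by (intro sum.cong) auto
    ultimately show ?thesis
      unfolding W_def B_def V_hat_def by (auto simp: space_pair_measure spF)
  qed
  finally show "measure (Pr R) B \<le> risk_V (params R k) * measure (Pr R) E" .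
qed

text \<open>For each \<open>J\<close> there are at most \<open>2 * (nF + nR)\<close> pairs of task
  and agent. Summing over all possible \<open>J\<close> is free of charge because every bound
  carries the probability of the event \<open>S_R R k \<omega> = J\<close>.\<close>

lemma rollout_bound:
  obtains B where "B \<in> sets (Pr R)" "measure (Pr R) B \<le> 2 * real (nF + nR) * risk_V (params R k)"
    and "\<And>\<omega> e b. \<omega> \<in> Cand R k \<inter> Ready S R k - B \<Longrightarrow> e \<in> {..<nF} <+> S_R R k \<omega> \<Longrightarrow>
      \<bar>V_hat S R k b e \<omega> - V S (eval_agent S R k b \<omega>) (eval_task S R k e \<omega>)\<bar> \<le> eps_V R k"
proof
  define E where "E J = {\<omega> \<in> Cand R k \<inter> Ready S R k. S_R R k \<omega> = J}" for J
  define B where "B J s = {\<omega> \<in> E J. \<bar>V_hat S R k (snd s) (fst s) \<omega>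
      - V S (eval_agent S R k (snd s) \<omega>) (eval_task S R k (fst s) \<omega>)\<bar> > eps_V R k}" for J s
  define I where "I J = ({..<nF} <+> J) \<times> (UNIV :: bool set)" for J :: "nat set"
  let ?B = "\<Union>J\<in>Pow {..<nR}. \<Union>s\<in>I J. B J s"
  have B: "B J s \<in> sets (Pr R)" "measure (Pr R) (B J s) \<le> risk_V (params R k) * measure (Pr R) (E J)"
    if "J \<in> Pow {..<nR}" "s \<in> I J" for J s
  proof -
    have "J \<subseteq> {..<nR}" "fst s \<in> {..<nF} <+> J" using that by (auto simp: I_def)
    from rollout_deviation[OF this, of "snd s"]
    show "B J s \<in> sets (Pr R)" "measure (Pr R) (B J s) \<le> risk_V (params R k) * measure (Pr R) (E J)"
      unfolding B_def E_def by auto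
  qed
  have E: "E J \<in> sets (Pr R)" if "J \<in> Pow {..<nR}" for J
    using rollouts_cond_law[of J] subalgebra_win_info that by (auto simp: E_def cond_law_on_def subalgebra_def)
  have I: "finite (I J)" "real (card (I J)) \<le> 2 * real (nF + nR)" if "J \<in> Pow {..<nR}" for J
  proof -
    have J: "finite J" "card J \<le> nR" using that finite_subset[of J] card_mono[of "{..<nR}" J] by auto
    show "finite (I J)" using J by (simp add: I_def)
    have "card (I J) = 2 * (nF + card J)" using J by (simp add: I_def card_cartesian_product card_Plus)
    then show "real (card (I J)) \<le> 2 * real (nF + nR)" using J by simp
  qed
  show "?B \<in> sets (Pr R)" using B I by (intro sets.finite_UN) auto
  have "measure (Pr R) ?B \<le> (\<Sum>J\<in>Pow {..<nR}. measure (Pr R) (\<Union>s\<in>I J. B J s))"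
    using B I by (intro P.finite_measure_subadditive_finite) auto
  also have "\<dots> \<le> (\<Sum>J\<in>Pow {..<nR}. 2 * real (nF + nR) * (risk_V (params R k) * measure (Pr R) (E J)))"
  proof (rule sum_mono)
    fix J assume J: "J \<in> Pow {..<nR}"
    have "measure (Pr R) (\<Union>s\<in>I J. B J s) \<le> (\<Sum>s\<in>I J. measure (Pr R) (B J s))"
      using B I J by (intro P.finite_measure_subadditive_finite) auto
    also have "\<dots> \<le> real (card (I J)) * (risk_V (params R k) * measure (Pr R) (E J))"
      using B(2)[OF J] by (rule sum_bounded_above)
    also have "\<dots> \<le> 2 * real (nF + nR) * (risk_V (params R k) * measure (Pr R) (E J))"
      using I(2)[OF J] params_pos by (intro mult_right_mono) auto
    finally show "measure (Pr R) (\<Union>s\<in>I J. B J s) \<le> \<dots>" .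
  qed
  also have "\<dots> = 2 * real (nF + nR) * risk_V (params R k) * (\<Sum>J\<in>Pow {..<nR}. measure (Pr R) (E J))"
    by (simp add: sum_distrib_left mult.assoc)
  \<comment> \<open>The events \<open>E J\<close> are disjoint, so their probabilities sum to at
    most 1.\<close>
  also have "(\<Sum>J\<in>Pow {..<nR}. measure (Pr R) (E J)) = measure (Pr R) (\<Union>J\<in>Pow {..<nR}. E J)"
    using E by (intro P.finite_measure_finite_Union[symmetric]) (auto simp: E_def disjoint_family_on_def)
  also have "2 * real (nF + nR) * risk_V (params R k) * \<dots> \<le> 2 * real (nF + nR) * risk_V (params R k) * 1"
    using params_pos by (intro mult_left_mono) auto
  finally show "measure (Pr R) ?B \<le> 2 * real (nF + nR) * risk_V (params R k)" by simp
  fix \<omega> e b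
  assume w: "\<omega> \<in> Cand R k \<inter> Ready S R k - ?B" and e: "e \<in> {..<nF} <+> S_R R k \<omega>"
  then have "S_R R k \<omega> \<in> Pow {..<nR}" "(e, b) \<in> I (S_R R k \<omega>)" by (auto simp: S_R_def I_def)
  then have "\<omega> \<notin> B (S_R R k \<omega>) (e, b)" using w by blast
  then show "\<bar>V_hat S R k b e \<omega> - V S (eval_agent S R k b \<omega>) (eval_task S R k e \<omega>)\<bar> \<le> eps_V R k"
    using w by (auto simp: B_def E_def)
qed

end

section \<open>Deterministic arithmetic of the two gates\<close>

text \<open>Reading of the letters: \<open>g\<close> and \<open>h\<close> are the batch averages of
  the estimated and the true advantages, \<open>E\<close> is the failure expectation,
  \<open>m\<close> and \<open>I\<close> are the empirical and the true retained loss,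
  \<open>Dh\<close> is \<open>D_hat\<close>, and \<open>B\<close> is the signed retained term of the
  gain.\<close>

lemma two_gate_arith:
  fixes Zh :: real
  assumes Z: "\<bar>Zh - z\<bar> \<le> eZ" "0 \<le> z" "0 \<le> Zh" "Zh < 1"
    and g: "\<bar>g\<bar> \<le> 1" "\<bar>h - g\<bar> \<le> 2 * eV" "\<bar>h - E\<bar> \<le> eF" "Zh * g \<ge> \<tau>"
    and m: "\<bar>m - I\<bar> \<le> eR" "m \<le> (1 - Zh) * (Dh + 2 * eV)" "Dh \<le> \<delta>" "- I \<le> B" "0 < \<delta>"
  shows "z * E + B \<ge> \<tau> - (eZ + (Zh + eZ) * (2 * eV + eF)) - (1 - Zh + eZ) * (\<delta> + (2 * eV + eR + eZ) / (1 - Zh))"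
proof -
  \<comment> \<open>Every radius is nonnegative because it dominates an absolute value.\<close>
  have pos: "0 \<le> eZ" "0 \<le> eV" "0 \<le> eF" "0 \<le> eR" using Z(1) g m by linarith+
  define x where "x = 2 * eV + eF"
  have x: "0 \<le> x" "\<bar>E - g\<bar> \<le> x" using pos g by (auto simp: x_def)
  \<comment> \<open>The failure term is decomposed as
    \<open>z * E = Zh * g - (Zh - z) * g - z * (g - E)\<close>. The first gate bounds the leading
    product, \<open>\<bar>g\<bar> \<le> 1\<close> the second, and \<open>z \<le> Zh + eZ\<close> the
    third.\<close>
  have "z * (g - E) \<le> z * x" using Z x by (intro mult_left_mono) auto
  also have "\<dots> \<le> (Zh + eZ) * x" using Z x by (intro mult_right_mono) auto
  finally have "z * (g - E) \<le> (Zh + eZ) * x" .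
  moreover have "(Zh - z) * g \<le> eZ"
  proof -
    have "(Zh - z) * g \<le> \<bar>Zh - z\<bar> * \<bar>g\<bar>" by (simp add: abs_mult[symmetric])
    also have "\<dots> \<le> eZ * 1" using Z g pos by (intro mult_mono) auto
    finally show ?thesis by simp
  qed
  ultimately have first: "z * E \<ge> \<tau> - (eZ + (Zh + eZ) * x)"
    using g(4) by (simp add: algebra_simps)
  \<comment> \<open>This is \<open>eps_D\<close>; its denominator is there to cancel against the
    fraction \<open>1 - Zh\<close> of unmarked records.\<close>
  define y where "y = (2 * eV + eR + eZ) / (1 - Zh)"
  have y: "0 \<le> y" "(1 - Zh) * y = 2 * eV + eR + eZ" using pos Z by (auto simp: y_def)
  have "(1 - Zh) * (Dh + 2 * eV) \<le> (1 - Zh) * (\<delta> + 2 * eV)" using m Z by (intro mult_left_mono) auto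
  \<comment> \<open>The factor \<open>1 - Zh \<le> 1\<close> is dropped from the rollout error,
    which then matches the numerator of \<open>y\<close>.\<close>
  also have "\<dots> \<le> (1 - Zh) * \<delta> + 2 * eV"
    using mult_right_mono[of "1 - Zh" 1 "2 * eV"] Z pos by (simp add: distrib_left)
  also have "\<dots> \<le> (1 - Zh) * (\<delta> + y) - eR" using y pos by (simp add: distrib_left)
  also have "\<dots> \<le> (1 - Zh + eZ) * (\<delta> + y) - eR" using y pos m by (simp add: distrib_right)
  finally have "B \<ge> - ((1 - Zh + eZ) * (\<delta> + y))" using m by linarith
  then show ?thesis using first by (simp add: x_def y_def)
qed

section \<open>The gain of a step\<close>

lemma abs_average_le:
  fixes x :: "nat \<Rightarrow> real"
  assumes "0 < n" "\<And>i. i < n \<Longrightarrow> \<bar>x i\<bar> \<le> c"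
  shows "\<bar>1 / real n * (\<Sum>i<n. x i)\<bar> \<le> c"
proof -
  have "\<bar>\<Sum>i<n. x i\<bar> \<le> (\<Sum>i<n. \<bar>x i\<bar>)" by (rule sum_abs)
  also have "\<dots> \<le> real n * c" using assms(2) sum_bounded_above[of "{..<n}" "\<lambda>i. \<bar>x i\<bar>" c] by simp
  finally show ?thesis using assms(1) by (simp add: abs_mult field_simps)
qed

context agent_step
begin

lemma V_hat_01:
  assumes w: "\<omega> \<in> space (Pr R)" and e: "e \<in> {..<nF} <+> {..<nR}"
  shows "V_hat S R k b e \<omega> \<in> {0..1}"
proof -
  have "eval_task S R k e \<omega> \<in> space T"
    using e fail_task_in[OF w] measurable_space[OF rec_task_P] w by (auto simp: eval_task_def)
  moreover have "rollout R k (e, b, l) \<omega> \<in> space Out" if "l < nV" for l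
    using that e by (intro measurable_space[OF rollout_P w]) (auto simp: rollout_index_def)
  ultimately have r: "reward S (eval_task S R k e \<omega>) (rollout R k (e, b, l) \<omega>) \<in> {0..1}" if "l < nV" for l
    using that reward_01 by blast
  have "\<bar>V_hat S R k b e \<omega>\<bar> \<le> 1"
    unfolding V_hat_def by (rule abs_average_le) (use params_pos r in auto)
  moreover have "0 \<le> V_hat S R k b e \<omega>"
    unfolding V_hat_def using r by (intro mult_nonneg_nonneg sum_nonneg) auto
  ultimately show ?thesis by simp
qed

text \<open>This is the conversion factor between division by the sample size in
  \<open>sample_loss\<close> and division by the number of unmarked records in
  \<open>D_hat\<close>.\<close>

lemma one_minus_Z_hat: "1 - Z_hat R k \<omega> = real (card (S_R R k \<omega>)) / real nR"
proof -
  have "(\<Sum>j<nR. of_bool (rec_label R k j \<omega>)) + (\<Sum>j<nR. of_bool (\<not> rec_label R k j \<omega>)) = (\<Sum>j<nR. 1 :: real)"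
    unfolding sum.distrib[symmetric] by (intro sum.cong) auto
  then have "(\<Sum>j<nR. of_bool (rec_label R k j \<omega>)) = real nR - real (card (S_R R k \<omega>))"
    by (simp add: card_S_R)
  then show ?thesis using params_pos by (simp add: Z_hat_def diff_divide_distrib)
qed

text \<open>A statement about a single \<omega>: all probabilistic input sits in the hypotheses, and
  what remains is \<open>J_diff\<close> combined with \<open>two_gate_arith\<close>.\<close>

lemma adopted_gain:
  assumes w: "\<omega> \<in> space (Pr R)" and adopt: "adopts S R k \<omega>"
    and Z: "\<bar>Z_hat R k \<omega> - Z S (agent R k \<omega>)\<bar> \<le> eps_Z S R k"
    and loss: "\<bar>sample_loss \<omega> - retained_mass \<omega>\<bar> \<le> eps_R S R k"
    and batch: "\<bar>1 / real nF * (\<Sum>i<nF. Adv S (agent R k \<omega>) (cand_total \<omega>) (fail_task S R k i \<omega>))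
        - (\<integral>t. Adv S (agent R k \<omega>) (cand_total \<omega>) t \<partial>D_F S (agent R k \<omega>))\<bar> \<le> eps_F R k \<omega>"
    and rollouts: "\<And>e b. e \<in> {..<nF} <+> S_R R k \<omega> \<Longrightarrow>
      \<bar>V_hat S R k b e \<omega> - V S (eval_agent S R k b \<omega>) (eval_task S R k e \<omega>)\<bar> \<le> eps_V R k"
  shows "Delta S R k \<omega> \<le> J_user S (agent R (Suc k) \<omega>) - J_user S (agent R k \<omega>)"
proof -
  have CR: "\<omega> \<in> Cand R k" "\<omega> \<in> Ready S R k" and L: "L_hat S R k \<omega> \<ge> tau (params R k)"
    and Dd: "D_hat S R k \<omega> \<le> delta (params R k)"
    using adopt by (auto simp: adopts_def)
  define A A' where "A = agent R k \<omega>" and "A' = cand_total \<omega>"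
  have A: "A \<in> space Ag" "A' \<in> space Ag" using agent_in cand_total_in w by (auto simp: A_def A'_def)
  have new_agent: "agent R (Suc k) \<omega> = A'"
    using upd w adopt cand_total_eq[OF CR(1)] by (simp add: two_gate_update_def A'_def)
  define d where "d e = V_hat S R k True e \<omega> - V_hat S R k False e \<omega>" for e
  define f where "f = Adv S A A'"
  have d_f: "\<bar>d e - f (eval_task S R k e \<omega>)\<bar> \<le> 2 * eps_V R k" if "e \<in> {..<nF} <+> S_R R k \<omega>" for e
    using rollouts[OF that, of True] rollouts[OF that, of False]
    by (auto simp: d_def f_def Adv_def A_def A'_def eval_agent_def cand_total_eq[OF CR(1)])
  have f1: "\<bar>f t\<bar> \<le> 1" if "t \<in> space T" for t
    using abs_Adv_le_1[OF A that] by (simp add: f_def)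
  define c where "c = card (S_R R k \<omega>)"
  \<comment> \<open>Readiness guarantees an unmarked record, so \<open>Z_hat\<close> is below 1 and
    the divisions in \<open>D_hat\<close> and \<open>eps_D\<close> are genuine.\<close>
  have c: "c > 0" using CR by (auto simp: Ready_def ReadyR_def c_def)
  have Zh: "1 - Z_hat R k \<omega> = real c / real nR" using one_minus_Z_hat by (simp add: c_def)
  have "tau (params R k) - (eps_Z S R k + (Z_hat R k \<omega> + eps_Z S R k) * (2 * eps_V R k + eps_F R k \<omega>))
      - (1 - Z_hat R k \<omega> + eps_Z S R k) *
        (delta (params R k) + (2 * eps_V R k + eps_R S R k + eps_Z S R k) / (1 - Z_hat R k \<omega>))
    \<le> Z S A * (\<integral>t. f t \<partial>D_F S A) + (\<integral>t. (1 - psi S A t) * f t \<partial>D)"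
  proof (rule two_gate_arith)
    show "0 \<le> Z S A" using Z_01[OF A(1)] by simp
    show "0 \<le> Z_hat R k \<omega>" unfolding Z_hat_def by (intro mult_nonneg_nonneg sum_nonneg) auto
    have "0 < 1 - Z_hat R k \<omega>" unfolding Zh using c params_pos by simp
    then show "Z_hat R k \<omega> < 1" by simp
    show "\<bar>1 / real nF * (\<Sum>i<nF. d (Inl i))\<bar> \<le> 1"
    proof (rule abs_average_le)
      fix i assume "i < nF"
      then have "Inl i \<in> {..<nF} <+> {..<nR}" by auto
      from V_hat_01[OF w this, of True] V_hat_01[OF w this, of False] show "\<bar>d (Inl i)\<bar> \<le> 1"
        by (auto simp: d_def)
    qed (use params_pos in simp)
    have "\<bar>1 / real nF * (\<Sum>i<nF. f (fail_task S R k i \<omega>) - d (Inl i))\<bar> \<le> 2 * eps_V R k"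
    proof (rule abs_average_le)
      fix i assume "i < nF"
      then have "Inl i \<in> {..<nF} <+> S_R R k \<omega>" by auto
      from d_f[OF this] show "\<bar>f (fail_task S R k i \<omega>) - d (Inl i)\<bar> \<le> 2 * eps_V R k"
        by (simp add: eval_task_def abs_minus_commute)
    qed (use params_pos in simp)
    then show "\<bar>1 / real nF * (\<Sum>i<nF. f (fail_task S R k i \<omega>)) - 1 / real nF * (\<Sum>i<nF. d (Inl i))\<bar> \<le> 2 * eps_V R k"
      by (simp only: sum_subtractf right_diff_distrib)
    show "tau (params R k) \<le> Z_hat R k \<omega> * (1 / real nF * (\<Sum>i<nF. d (Inl i)))"
      using L by (simp add: L_hat_def d_def)
    show "sample_loss \<omega> \<le> (1 - Z_hat R k \<omega>) * (D_hat S R k \<omega> + 2 * eps_V R k)"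
    proof -
      have "sample_loss \<omega> = 1 / real nR * (\<Sum>j\<in>S_R R k \<omega>. \<bar>f (rec_task R k j \<omega>)\<bar>)"
        unfolding sample_loss_def sum_S_R by (simp add: f_def A_def A'_def)
      also have "\<dots> \<le> 1 / real nR * (\<Sum>j\<in>S_R R k \<omega>. \<bar>d (Inr j)\<bar> + 2 * eps_V R k)"
      proof (intro mult_left_mono sum_mono)
        fix j assume "j \<in> S_R R k \<omega>"
        then have "Inr j \<in> {..<nF} <+> S_R R k \<omega>" by auto
        from d_f[OF this] show "\<bar>f (rec_task R k j \<omega>)\<bar> \<le> \<bar>d (Inr j)\<bar> + 2 * eps_V R k"
          by (simp add: eval_task_def)
      qed simp
      also have "\<dots> = 1 / real nR * (real c * D_hat S R k \<omega> + real c * (2 * eps_V R k))"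
        using c by (simp add: sum.distrib D_hat_def d_def c_def)
      also have "\<dots> = (1 - Z_hat R k \<omega>) * (D_hat S R k \<omega> + 2 * eps_V R k)"
        unfolding Zh by (simp add: algebra_simps)
      finally show ?thesis .
    qed
    \<comment> \<open>The second gate controls only absolute changes on unmarked tasks, so the worst
      sign of \<open>f\<close> is assumed.\<close>
    show "- retained_mass \<omega> \<le> (\<integral>t. (1 - psi S A t) * f t \<partial>D)"
    proof -
      have m: "psi S A \<in> borel_measurable T" "f \<in> borel_measurable T"
        using psi_measurable1 Adv_measurable1 A by (auto simp: f_def)
      have p: "0 \<le> 1 - psi S A t" "1 - psi S A t \<le> 1" if "t \<in> space T" for t
        using psi_01[OF A(1) that] by auto
      have "(\<integral>t. - ((1 - psi S A t) * \<bar>f t\<bar>) \<partial>D) \<le> (\<integral>t. (1 - psi S A t) * f t \<partial>D)"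
      proof (rule integral_mono)
        show "integrable D (\<lambda>t. - ((1 - psi S A t) * \<bar>f t\<bar>))" "integrable D (\<lambda>t. (1 - psi S A t) * f t)"
          using m p f1 by (auto intro!: integrable_user mult_le_one simp: abs_mult)
        fix t assume "t \<in> space D"
        then have "(1 - psi S A t) * - \<bar>f t\<bar> \<le> (1 - psi S A t) * f t"
          using p by (intro mult_left_mono) auto
        then show "- ((1 - psi S A t) * \<bar>f t\<bar>) \<le> (1 - psi S A t) * f t" by simp
      qed
      then show ?thesis by (simp add: retained_mass_def f_def A_def A'_def)
    qed
  qed (use Z loss batch Dd params_pos in \<open>simp_all add: f_def A_def A'_def\<close>)
  then show ?thesis
    using J_diff[OF A] CR new_agent by (simp add: Delta_def eps_L_def eps_D_def f_def A_def)
qed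

text \<open>The batch and rollout bounds speak only about \<omega> with a candidate and ready
  samples, and adoption implies both. Without adoption the agent is unchanged, so both sides are 0
  and no estimate is involved.\<close>

lemma step_gain:
  obtains B where "B \<in> sets (Pr R)" "measure (Pr R) B \<le> step_risk (params R k)"
    and "\<And>\<omega>. \<omega> \<in> space (Pr R) - B \<Longrightarrow>
      (if adopts S R k \<omega> then Delta S R k \<omega> else 0) \<le> J_user S (agent R (Suc k) \<omega>) - J_user S (agent R k \<omega>)"
proof -
  obtain BF where BF: "BF \<in> sets (Pr R)" "measure (Pr R) BF \<le> risk_F (params R k)"
    "\<And>\<omega>. \<omega> \<in> Cand R k \<inter> RetF S R k - BF \<Longrightarrow>
      \<bar>1 / real nF * (\<Sum>i<nF. Adv S (agent R k \<omega>) (cand_total \<omega>) (fail_task S R k i \<omega>))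
        - (\<integral>t. Adv S (agent R k \<omega>) (cand_total \<omega>) t \<partial>D_F S (agent R k \<omega>))\<bar> \<le> eps_F R k \<omega>"
    by (rule batch_bound) blast
  obtain BV where BV: "BV \<in> sets (Pr R)" "measure (Pr R) BV \<le> 2 * real (nF + nR) * risk_V (params R k)"
    "\<And>\<omega> e b. \<omega> \<in> Cand R k \<inter> Ready S R k - BV \<Longrightarrow> e \<in> {..<nF} <+> S_R R k \<omega> \<Longrightarrow>
      \<bar>V_hat S R k b e \<omega> - V S (eval_agent S R k b \<omega>) (eval_task S R k e \<omega>)\<bar> \<le> eps_V R k"
    by (rule rollout_bound) blast
  define BZ where "BZ = {\<omega> \<in> space (Pr R). \<bar>Z_hat R k \<omega> - Z S (agent R k \<omega>)\<bar> > eps_Z S R k}"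
  define BR where "BR = {\<omega> \<in> space (Pr R). \<bar>sample_loss \<omega> - retained_mass \<omega>\<bar> > eps_R S R k}"
  have BZ: "BZ \<in> sets (Pr R)" "measure (Pr R) BZ \<le> risk_Z (params R k)"
    using Z_hat_bound unfolding BZ_def by measurable
  have [measurable]: "sample_loss \<in> borel_measurable (Pr R)"
    unfolding sample_loss_def[abs_def] by measurable
  have [measurable]: "retained_mass \<in> borel_measurable (Pr R)"
    unfolding retained_mass_def[abs_def] by (rule U.borel_measurable_lebesgue_integral) measurable
  have BR: "BR \<in> sets (Pr R)" "measure (Pr R) BR \<le> risk_R (params R k)"
    using sample_loss_bound unfolding BR_def by measurable
  show ?thesis
  proof
    show "BZ \<union> BR \<union> BF \<union> BV \<in> sets (Pr R)" using BZ BR BF BV by auto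
    have "measure (Pr R) (BZ \<union> BR \<union> BF \<union> BV)
        \<le> measure (Pr R) BZ + measure (Pr R) BR + measure (Pr R) BF + measure (Pr R) BV"
      using measure_Un_le[of "BZ \<union> BR \<union> BF" "Pr R" BV] measure_Un_le[of "BZ \<union> BR" "Pr R" BF]
        measure_Un_le[of BZ "Pr R" BR] BZ(1) BR(1) BF(1) BV(1) by auto
    also have "\<dots> \<le> step_risk (params R k)"
      using BZ BR BF BV params_pos by (simp add: step_risk_def)
    finally show "measure (Pr R) (BZ \<union> BR \<union> BF \<union> BV) \<le> step_risk (params R k)" .
    fix \<omega> assume w: "\<omega> \<in> space (Pr R) - (BZ \<union> BR \<union> BF \<union> BV)"
    show "(if adopts S R k \<omega> then Delta S R k \<omega> else 0) \<le> J_user S (agent R (Suc k) \<omega>) - J_user S (agent R k \<omega>)"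
    proof (cases "adopts S R k \<omega>")
      case True
      then have CR: "\<omega> \<in> Cand R k \<inter> Ready S R k" by (simp add: adopts_def)
      have "Delta S R k \<omega> \<le> J_user S (agent R (Suc k) \<omega>) - J_user S (agent R k \<omega>)"
      proof (rule adopted_gain[OF _ True])
        show "\<bar>Z_hat R k \<omega> - Z S (agent R k \<omega>)\<bar> \<le> eps_Z S R k" using w by (auto simp: BZ_def)
        show "\<bar>sample_loss \<omega> - retained_mass \<omega>\<bar> \<le> eps_R S R k" using w by (auto simp: BR_def)
      qed (use w CR BF(3) BV(3) in \<open>auto simp: Ready_def\<close>)
      then show ?thesis using True by simp
    next
      case False
      then show ?thesis using upd w by (simp add: two_gate_update_def)
    qed
  qed
qed

end

section \<open>Telescoping and union bound over the run\<close>

theorem theorem4: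
  fixes S :: "('t, 'o, 'c) setting" and R :: "('w, 't, 'o, 'c) run"
    and K :: nat and \<beta>_run :: real
  assumes "valid_setting S"
    and "valid_run S R K"
    and "\<And>k. k < K \<Longrightarrow> one_candidate_step S R k"
    and "\<And>k. k < K \<Longrightarrow> standard_conditions S R k"
    and "(\<Sum>k<K. step_risk (params R k)) \<le> \<beta>_run"
  shows "measure (Pr R) {\<omega> \<in> space (Pr R).
           J_user S (agent R K \<omega>) - J_user S (agent R 0 \<omega>) \<ge> (\<Sum>k\<in>adopted S R K \<omega>. Delta S R k \<omega>)}
         \<ge> 1 - \<beta>_run"
proof -
  interpret agent_run S R K by unfold_locales fact+
  have step: "agent_step S R K k" if "k < K" for k
    using assms that by unfold_locales auto
  define gain where "gain k \<omega> = (if adopts S R k \<omega> then Delta S R k \<omega> else 0)" for k \<omega>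
  have "\<exists>B. B \<in> sets (Pr R) \<and> measure (Pr R) B \<le> step_risk (params R k) \<and>
      (\<forall>\<omega>\<in>space (Pr R) - B. gain k \<omega> \<le> J_user S (agent R (Suc k) \<omega>) - J_user S (agent R k \<omega>))"
    if "k < K" for k
    using agent_step.step_gain[OF step[OF that]] unfolding gain_def by metis
  then obtain B where B: "\<And>k. k < K \<Longrightarrow> B k \<in> sets (Pr R)"
      "\<And>k. k < K \<Longrightarrow> measure (Pr R) (B k) \<le> step_risk (params R k)"
    and gain: "\<And>k \<omega>. k < K \<Longrightarrow> \<omega> \<in> space (Pr R) - B k \<Longrightarrow>
        gain k \<omega> \<le> J_user S (agent R (Suc k) \<omega>) - J_user S (agent R k \<omega>)"
    by metis
  let ?B = "\<Union>k<K. B k"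
  let ?E = "{\<omega> \<in> space (Pr R). J_user S (agent R K \<omega>) - J_user S (agent R 0 \<omega>)
      \<ge> (\<Sum>k\<in>adopted S R K \<omega>. Delta S R k \<omega>)}"
  \<comment> \<open>Replacing the random index set by a zero gain at steps without adoption allows a
    comparison step by step with the telescoping sum.\<close>
  have sum_gain: "(\<Sum>k\<in>adopted S R K \<omega>. Delta S R k \<omega>) = (\<Sum>k<K. gain k \<omega>)" for \<omega>
  proof -
    have "adopted S R K \<omega> = {k \<in> {..<K}. adopts S R k \<omega>}" by (auto simp: adopted_def)
    then show ?thesis by (simp only: gain_def sum.inter_filter[OF finite_lessThan])
  qed
  have [measurable]: "gain k \<in> borel_measurable (Pr R)" if "k < K" for k
    using agent_step.adopts_measurable[OF step[OF that]] agent_step.Delta_measurable[OF step[OF that]]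
    unfolding gain_def[abs_def] by measurable
  have [measurable]: "agent R K \<in> Pr R \<rightarrow>\<^sub>M agent_space S" "agent R 0 \<in> Pr R \<rightarrow>\<^sub>M agent_space S"
    by (auto intro: agent_measurable)
  \<comment> \<open>Monotonicity of the measure needs the larger set to be measurable, so this
    cannot be skipped for a lower bound.\<close>
  have E: "?E \<in> sets (Pr R)" unfolding sum_gain by measurable
  have Bsets: "?B \<in> sets (Pr R)" using B by auto
  have sub: "space (Pr R) - ?B \<subseteq> ?E"
  proof
    fix \<omega> assume w: "\<omega> \<in> space (Pr R) - ?B"
    have "(\<Sum>k<K. gain k \<omega>) \<le> (\<Sum>k<K. J_user S (agent R (Suc k) \<omega>) - J_user S (agent R k \<omega>))"
      using w gain by (intro sum_mono) auto
    also have "\<dots> = J_user S (agent R K \<omega>) - J_user S (agent R 0 \<omega>)"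
      by (rule sum_lessThan_telescope)
    finally show "\<omega> \<in> ?E" using w unfolding sum_gain by simp
  qed
  have "1 - measure (Pr R) ?B \<le> measure (Pr R) ?E"
    using P.finite_measure_mono[OF sub E] P.prob_compl[OF Bsets] by simp
  moreover have "measure (Pr R) ?B \<le> (\<Sum>k<K. measure (Pr R) (B k))"
    using B by (intro P.finite_measure_subadditive_finite) auto
  moreover have "(\<Sum>k<K. measure (Pr R) (B k)) \<le> (\<Sum>k<K. step_risk (params R k))"
    using B by (intro sum_mono) auto
  ultimately show ?thesis using assms(5) by linarith
qed

end
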